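(* Let $G$ be an Eulerian directed graph with vertex set $V$, $|V|=n\geq2$, and maximum degree $d$, and let $\mathsf{P}$ be the transition matrix of the max-degree walk on $G$ (whose stationary distribution is uniform on $V$). (1) The spectral gap of $\mathsf{P}$ satisfies $$\lambda\ \geq\ \frac2d\left(1-\cos\frac{\pi}{n}\right).$$ (2) Suppose in addition that $$\forall A\subset V,\ A\neq\emptyset,\ |A|\leq|V|/2:\quad |N(A)|>|A|.$$ Then every (complex) eigenvalue $\lambda_i\neq1$ of $\mathsf{P}$ satisfies $$1-|\lambda_i|\ \geq\ \frac2d\left(1-\cos\frac{\pi}{n}\right),$$ and for every $\epsilon>0$ $$\tau(\epsilon)\ \leq\ \frac{1}{-\log\left(1-\frac2d\left(1-\cos\frac{\pi}{n}\right)\right)}\,\log\frac{1-1/n}{\epsilon},$$ $$\tau_\infty(\epsilon)\ \leq\ \begin{cases}\displaystyle\min\left\{\frac{\log(n-1)+\log\frac1\epsilon}{-\log\left(1-\frac2d\left(1-\cos\frac{\pi}{n}\right)\right)},\ \frac{n^2d}{3}+\frac{n^2d}{4}\log\frac1\epsilon\right\} & \text{if }\epsilon\leq1,\\[2ex] \displaystyle n^2d\,\frac23\,\frac{1+3\epsilon}{(1+\epsilon)^3} & \text{if }\epsilon>1.\end{cases}$$ (3) For the lazy max-degree walk on $G$, with transition matrix $\frac12(I+\mathsf{P})$ (and with no expansion condition assumed beyond the strong connectivity of $G$), the spectral gap satisfies $\lambda\geq\frac1d\left(1-\cos\frac{\pi}{n}\right)$, every eigenvalue $\lambda_i\neq1$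 of the transition matrix satisfies $1-|\lambda_i|\geq\frac1d\left(1-\cos\frac{\pi}{n}\right)$, and for every $\epsilon>0$ $$\tau(\epsilon)\ \leq\ \frac{1}{-\log\left(1-\frac1d\left(1-\cos\frac{\pi}{n}\right)\right)}\,\log\frac{1-1/n}{\epsilon},$$ $$\tau_\infty(\epsilon)\ \leq\ \begin{cases}\displaystyle\min\left\{\frac{\log(n-1)+\log\frac1\epsilon}{-\log\left(1-\frac1d\left(1-\cos\frac{\pi}{n}\right)\right)},\ \frac{2n^2d}{3}+\frac{n^2d}{2}\log\frac1\epsilon\right\} & \text{if }\epsilon\leq1,\\[2ex] \displaystyle n^2d\,\frac43\,\frac{1+3\epsilon}{(1+\epsilon)^3} & \text{if }\epsilon>1.\end{cases}$$
   Context: An Eulerian graph is a finite, strongly connected directed graph in which every vertex $x$ has in-degree equal to its out-degree; this common value is denoted $\deg(x)$. Self-loops and parallel edges are allowed. $d=\max_x\deg(x)$. The max-degree walk at $x$ follows each outgoing edge with probability $1/d$ and otherwise (with probability $1-\deg(x)/d$) stays at $x$. Its stationary distribution $\pi$ is uniform on $V$. (Inside cosines $\pi$ is the usual constant.) For $A\subset V$, $N(A)=\{y\in V:\exists x\in A,\ \mathsf{P}(x,y)>0\}$. Spectral gap of an irreducible transition matrix $\mathsf{P}$ with stationary distribution $\pi$: with $\mathsf{P}^*(x,y)=\pi(y)\mathsf{P}(y,x)/\pi(x)$, $\lambda$ is the difference between the two largest eigenvalues of $\frac{\mathsf{P}+\mathsf{P}^*}{2}$, i.e. $$\lambda=\inf_{f:\,\mathrm{Var}_\pi(f)\neq0}\frac{\frac12\sum_{x,y}(f(x)-f(y))^2\pi(x)\mathsf{P}(x,y)}{\frac12\sum_{x,y}(f(x)-f(y))^2\pi(x)\pi(y)}.$$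 Mixing times: $\tau(\epsilon)$ is the worst-case (over the starting vertex $x$) number of steps $t$ needed for $\|\mathsf{P}^t(x,\cdot)-\pi\|_{TV}=\frac12\sum_y|\mathsf{P}^t(x,y)-\pi(y)|$ to drop to $\epsilon$; $\tau_\infty(\epsilon)$ is the same with the distance $\max_y\left|\frac{\mathsf{P}^t(x,y)}{\pi(y)}-1\right|$. A bound "mixing time $\leq T$" with $T$ real means: for every positive integer $t\geq T$ and every $x\in V$, the corresponding distance at time $t$ is at most $\epsilon$. By convention $\log0=-\infty$ and $1/\infty=0$ (so $\frac{1}{-\log0}=0$). *)

theory Defs
  imports Complex_Main "Graph_Theory.Graph_Theory"
begin

section \<open>Eulerian digraphs and the max-degree walk\<close>

text \<open>Arcs have their own type, so parallel arcs and self-loops are allowed.\<close>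

definition eulerian_digraph :: "('a, 'b) pre_digraph \<Rightarrow> bool" where
  "eulerian_digraph G \<longleftrightarrow>
     fin_digraph G \<and> strongly_connected G \<and>
     (\<forall>x\<in>verts G. in_degree G x = out_degree G x)"

definition max_degree :: "('a, 'b) pre_digraph \<Rightarrow> nat" where
  "max_degree G = Max (out_degree G ` verts G)"

definition max_degree_walk :: "('a, 'b) pre_digraph \<Rightarrow> 'a \<Rightarrow> 'a \<Rightarrow> real" where
  "max_degree_walk G x y =
     real (card {e \<in> arcs G. tail G e = x \<and> head G e = y}) / real (max_degree G)
     + (if x = y then 1 - real (out_degree G x) / real (max_degree G) else 0)"


section \<open>Finite Markov chains\<close>

text \<open>
  Transition matrices, distributions and functions on a finite state space \<open>V\<close> are functions on
  the whole type; only their values on \<open>V\<close> matter.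
\<close>

definition lazy :: "('a \<Rightarrow> 'a \<Rightarrow> real) \<Rightarrow> 'a \<Rightarrow> 'a \<Rightarrow> real" where
  "lazy P x y = ((if x = y then 1 else 0) + P x y) / 2"

definition uniform_dist :: "'a set \<Rightarrow> 'a \<Rightarrow> real" where
  "uniform_dist V x = 1 / real (card V)"

definition nbrs :: "'a set \<Rightarrow> ('a \<Rightarrow> 'a \<Rightarrow> real) \<Rightarrow> 'a set \<Rightarrow> 'a set" where
  "nbrs V P A = {y \<in> V. \<exists>x\<in>A. P x y > 0}"

definition stationary :: "'a set \<Rightarrow> ('a \<Rightarrow> 'a \<Rightarrow> real) \<Rightarrow> ('a \<Rightarrow> real) \<Rightarrow> bool" where
  "stationary V P \<nu> \<longleftrightarrow>
     (\<forall>x\<in>V. 0 \<le> \<nu> x) \<and> (\<Sum>x\<in>V. \<nu> x) = 1 \<and> (\<forall>y\<in>V. (\<Sum>x\<in>V. \<nu> x * P x y) = \<nu> y)"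

fun matrix_pow :: "'a set \<Rightarrow> ('a \<Rightarrow> 'a \<Rightarrow> real) \<Rightarrow> nat \<Rightarrow> 'a \<Rightarrow> 'a \<Rightarrow> real" where
  "matrix_pow V P 0 x y = (if x = y then 1 else 0)"
| "matrix_pow V P (Suc t) x y = (\<Sum>z\<in>V. P x z * matrix_pow V P t z y)"

text \<open>Complex eigenvalues of the \<open>V \<times> V\<close> matrix \<open>P\<close>.\<close>

definition is_eigenvalue :: "'a set \<Rightarrow> ('a \<Rightarrow> 'a \<Rightarrow> real) \<Rightarrow> complex \<Rightarrow> bool" where
  "is_eigenvalue V P z \<longleftrightarrow>
     (\<exists>f :: 'a \<Rightarrow> complex. (\<exists>x\<in>V. f x \<noteq> 0) \<and>
        (\<forall>x\<in>V. (\<Sum>y\<in>V. complex_of_real (P x y) * f y) = z * f x))"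

definition variance :: "'a set \<Rightarrow> ('a \<Rightarrow> real) \<Rightarrow> ('a \<Rightarrow> real) \<Rightarrow> real" where
  "variance V \<nu> f = (\<Sum>x\<in>V. \<nu> x * (f x - (\<Sum>y\<in>V. \<nu> y * f y))\<^sup>2)"

text \<open>
  The infimum is over a set of nonnegative reals, nonempty when \<open>\<nu>\<close> is positive on at least
  two states, so it is a genuine infimum.
\<close>

definition spectral_gap :: "'a set \<Rightarrow> ('a \<Rightarrow> real) \<Rightarrow> ('a \<Rightarrow> 'a \<Rightarrow> real) \<Rightarrow> real" where
  "spectral_gap V \<nu> P =
     (INF f \<in> {f. variance V \<nu> f \<noteq> 0}.
        (1/2 * (\<Sum>x\<in>V. \<Sum>y\<in>V. (f x - f y)\<^sup>2 * \<nu> x * P x y)) /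
        (1/2 * (\<Sum>x\<in>V. \<Sum>y\<in>V. (f x - f y)\<^sup>2 * \<nu> x * \<nu> y)))"


section \<open>Mixing times\<close>

definition tv_dist :: "'a set \<Rightarrow> ('a \<Rightarrow> real) \<Rightarrow> ('a \<Rightarrow> 'a \<Rightarrow> real) \<Rightarrow> nat \<Rightarrow> 'a \<Rightarrow> real" where
  "tv_dist V \<nu> P t x = 1/2 * (\<Sum>y\<in>V. \<bar>matrix_pow V P t x y - \<nu> y\<bar>)"

definition linf_dist :: "'a set \<Rightarrow> ('a \<Rightarrow> real) \<Rightarrow> ('a \<Rightarrow> 'a \<Rightarrow> real) \<Rightarrow> nat \<Rightarrow> 'a \<Rightarrow> real" where
  "linf_dist V \<nu> P t x = Max ((\<lambda>y. \<bar>matrix_pow V P t x y / \<nu> y - 1\<bar>) ` V)"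

text \<open>
  \<open>tv_mixing_le V \<nu> P \<epsilon> T\<close> and \<open>linf_mixing_le V \<nu> P \<epsilon> T\<close> mean \<open>\<tau>(\<epsilon>) \<le> T\<close> and
  \<open>\<tau>\<^sub>\<infinity>(\<epsilon>) \<le> T\<close>. The bound \<open>T\<close> may be nonpositive; only positive times are considered.
\<close>

definition tv_mixing_le ::
  "'a set \<Rightarrow> ('a \<Rightarrow> real) \<Rightarrow> ('a \<Rightarrow> 'a \<Rightarrow> real) \<Rightarrow> real \<Rightarrow> real \<Rightarrow> bool" where
  "tv_mixing_le V \<nu> P \<epsilon> T \<longleftrightarrow>
     (\<forall>t::nat. 0 < t \<longrightarrow> T \<le> real t \<longrightarrow> (\<forall>x\<in>V. tv_dist V \<nu> P t x \<le> \<epsilon>))"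

definition linf_mixing_le ::
  "'a set \<Rightarrow> ('a \<Rightarrow> real) \<Rightarrow> ('a \<Rightarrow> 'a \<Rightarrow> real) \<Rightarrow> real \<Rightarrow> real \<Rightarrow> bool" where
  "linf_mixing_le V \<nu> P \<epsilon> T \<longleftrightarrow>
     (\<forall>t::nat. 0 < t \<longrightarrow> T \<le> real t \<longrightarrow> (\<forall>x\<in>V. linf_dist V \<nu> P t x \<le> \<epsilon>))"

text \<open>\<open>1 / (- log q)\<close> with the conventions \<open>log 0 = -\<infinity>\<close> and \<open>1 / \<infinity> = 0\<close>.\<close>

definition inv_neg_log :: "real \<Rightarrow> real" where
  "inv_neg_log q = (if q = 0 then 0 else 1 / (- ln q))"


section \<open>The stationary distribution of the max-degree walk is uniform\<close>

lemma sum_card_fibres: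
  assumes "finite E" "finite V" "h ` E \<subseteq> V"
  shows "(\<Sum>y\<in>V. card {e \<in> E. h e = y}) = card E"
  using sum.group[OF assms, of "\<lambda>_. 1::nat"] by simp

context
  fixes G :: "('a, 'b) pre_digraph"
  assumes eul: "eulerian_digraph G" and two: "card (verts G) \<ge> 2"
begin

interpretation fin_digraph G
  using eul by (simp add: eulerian_digraph_def)

lemma eulerian_max_degree_pos: "max_degree G > 0"
proof -
  obtain u v where uv: "u \<in> verts G" "v \<in> verts G" "u \<noteq> v"
    using two card_le_Suc0_iff_eq[OF finite_verts] by fastforce
  have "u \<rightarrow>\<^sup>*\<^bsub>G\<^esub> v"
    using eul uv by (auto simp: eulerian_digraph_def strongly_connected_def)
  then obtain w where "u \<rightarrow>\<^bsub>G\<^esub> w"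
    using uv(3) by (metis converse_reachable_cases)
  then have "out_arcs G u \<noteq> {}"
    by (auto simp: out_arcs_def arcs_ends_conv)
  then have "out_degree G u > 0"
    by (simp add: out_degree_def card_gt_0_iff finite_out_arcs)
  also have "out_degree G u \<le> max_degree G"
    unfolding max_degree_def using uv by (intro Max_ge) auto
  finally show ?thesis .
qed

lemma out_degree_le_max:
  assumes "x \<in> verts G"
  shows "0 \<le> 1 - real (out_degree G x) / real (max_degree G)"
proof -
  have "out_degree G x \<le> max_degree G"
    unfolding max_degree_def using assms by (intro Max_ge) auto
  then show ?thesis
    using eulerian_max_degree_pos by simp
qed

lemma max_degree_walk_nonneg:
  assumes "x \<in> verts G"
  shows "max_degree_walk G x y \<ge> 0"
proof -
  have "0 \<le> (if x = y then 1 - real (out_degree G x) / real (max_degree G) else 0)"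
    using out_degree_le_max[OF assms] by (cases "x = y") simp_all
  then show ?thesis
    unfolding max_degree_walk_def by (intro add_nonneg_nonneg) auto
qed

lemma max_degree_walk_row_sum:
  assumes "x \<in> verts G"
  shows "(\<Sum>y\<in>verts G. max_degree_walk G x y) = 1"
proof -
  have "(\<Sum>y\<in>verts G. card {e \<in> out_arcs G x. head G e = y}) = card (out_arcs G x)"
    by (rule sum_card_fibres) (auto simp: finite_out_arcs)
  then have "(\<Sum>y\<in>verts G. real (card {e \<in> arcs G. tail G e = x \<and> head G e = y}))
      = real (out_degree G x)"
    by (simp add: out_degree_def out_arcs_def conj_assoc flip: of_nat_sum)
  then show ?thesis
    using assms by (simp add: max_degree_walk_def sum.distrib flip: sum_divide_distrib)
qed

lemma max_degree_walk_column_sum: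
  assumes "y \<in> verts G"
  shows "(\<Sum>x\<in>verts G. max_degree_walk G x y) = 1"
proof -
  have "(\<Sum>x\<in>verts G. card {e \<in> in_arcs G y. tail G e = x}) = card (in_arcs G y)"
    by (rule sum_card_fibres) (auto simp: finite_in_arcs)
  moreover have "{e \<in> in_arcs G y. tail G e = x} = {e \<in> arcs G. tail G e = x \<and> head G e = y}"
    for x by (auto simp: in_arcs_def)
  ultimately have "(\<Sum>x\<in>verts G. real (card {e \<in> arcs G. tail G e = x \<and> head G e = y}))
      = real (in_degree G y)"
    by (simp add: in_degree_def flip: of_nat_sum)
  moreover have "in_degree G y = out_degree G y"
    using eul assms by (simp add: eulerian_digraph_def)
  ultimately show ?thesis
    using assms by (simp add: max_degree_walk_def sum.distrib flip: sum_divide_distrib)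
qed

lemma stationary_uniform: "stationary (verts G) (max_degree_walk G) (uniform_dist (verts G))"
  using two max_degree_walk_column_sum
  by (auto simp: stationary_def uniform_dist_def simp flip: sum_divide_distrib)

lemma stationary_max_degree_walk_unique:
  assumes st: "stationary (verts G) (max_degree_walk G) \<nu>" and "x \<in> verts G"
  shows "\<nu> x = uniform_dist (verts G) x"
proof -
  let ?V = "verts G" and ?P = "max_degree_walk G"
  define M where "M = Max (\<nu> ` ?V)"
  have ne: "?V \<noteq> {}" using assms by auto
  have le: "\<nu> z \<le> M" if "z \<in> ?V" for z
    using that by (auto simp: M_def)
  obtain m where m: "m \<in> ?V" "\<nu> m = M"
    using Max_in[of "\<nu> ` ?V"] ne unfolding M_def by fastforce
  have pred_max: "\<nu> u = M" if uv: "u \<rightarrow>\<^bsub>G\<^esub> v" and v: "\<nu> v = M" for u v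
  proof (rule ccontr)
    assume neq: "\<nu> u \<noteq> M"
    have V: "u \<in> ?V" "v \<in> ?V" using uv by (auto simp: arcs_ends_conv)
    have "{e \<in> arcs G. tail G e = u \<and> head G e = v} \<noteq> {}"
      using uv by (auto simp: arcs_ends_conv)
    then have "card {e \<in> arcs G. tail G e = u \<and> head G e = v} > 0"
      by (simp add: card_gt_0_iff)
    then have "0 < real (card {e \<in> arcs G. tail G e = u \<and> head G e = v}) / real (max_degree G)"
      using eulerian_max_degree_pos by simp
    moreover have "0 \<le> (if u = v then 1 - real (out_degree G u) / real (max_degree G) else 0)"
      using out_degree_le_max[OF V(1)] by (cases "u = v") simp_all
    ultimately have pos: "?P u v > 0"
      unfolding max_degree_walk_def by (rule add_pos_nonneg)
    have "(\<Sum>z\<in>?V. \<nu> z * ?P z v) < (\<Sum>z\<in>?V. M * ?P z v)"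
    proof (rule sum_strict_mono_ex1)
      show "\<forall>z\<in>?V. \<nu> z * ?P z v \<le> M * ?P z v"
        using le max_degree_walk_nonneg by (auto intro: mult_right_mono)
      show "\<exists>z\<in>?V. \<nu> z * ?P z v < M * ?P z v"
        using V pos neq le[of u] by (intro bexI[of _ u]) auto
    qed auto
    also have "\<dots> = M"
      using max_degree_walk_column_sum[OF V(2)] by (simp flip: sum_distrib_left)
    finally show False
      using st V v by (simp add: stationary_def)
  qed
  have const: "\<nu> u = M" if "u \<in> ?V" for u
  proof -
    have "u \<rightarrow>\<^sup>*\<^bsub>G\<^esub> m"
      using eul that m by (auto simp: eulerian_digraph_def strongly_connected_def)
    then show ?thesis
      by (induct rule: converse_reachable_induct) (use m pred_max in auto)
  qed
  have "real (card ?V) * M = 1"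
    using st const by (simp add: stationary_def)
  then show ?thesis
    using const[OF assms(2)] by (metis nonzero_eq_divide_eq mult.commute mult_zero_left
        uniform_dist_def zero_neq_one)
qed

end

lemma stationary_lazy:
  assumes "finite V"
  shows "stationary V (lazy P) \<nu> \<longleftrightarrow> stationary V P \<nu>"
proof -
  have "(\<Sum>x\<in>V. \<nu> x * lazy P x y) = (\<nu> y + (\<Sum>x\<in>V. \<nu> x * P x y)) / 2" if "y \<in> V" for y
  proof -
    have "(\<Sum>x\<in>V. \<nu> x * lazy P x y)
        = (\<Sum>x\<in>V. ((if x = y then \<nu> y else 0) + \<nu> x * P x y) / 2)"
      by (rule sum.cong) (auto simp: lazy_def algebra_simps)
    also have "\<dots> = ((\<Sum>x\<in>V. if x = y then \<nu> y else 0) + (\<Sum>x\<in>V. \<nu> x * P x y)) / 2"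
      by (simp add: sum.distrib flip: sum_divide_distrib)
    finally show ?thesis using assms that by simp
  qed
  then show ?thesis by (auto simp: stationary_def)
qed

end

theory Submission
  imports Defs "HOL-Analysis.L2_Norm"
begin

text \<open>
  The proof uses evolving sets. Write the walk as a matrix of natural numbers with all row and column
  sums equal to \<open>D\<close>. From \<open>A\<close> move to the set of all states that receive at least \<open>j\<close> units of weight
  from \<open>A\<close>, with \<open>j\<close> uniform in \<open>{1..D}\<close>. The size of the set is a martingale, and \<open>P^t(x, y)\<close> is the
  probability that \<open>y\<close> is in the set at time \<open>t\<close> when the start is \<open>{x}\<close> (\<open>matrix_pow_eq_evolve\<close>). So the
  total variation distance is at most the mean of \<open>k (n - k) / n\<close>, and the \<open>L2\<close> distance is controlled by
  the mean of \<open>sqrt (k (n - k))\<close>, where \<open>k\<close> is the size at time \<open>t\<close>; the maximal relative deviation is a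
  product of two \<open>L2\<close> distances, one of them for the reversed walk.

  The decay comes from a drift \<open>\<delta>\<close>: from each proper set the positive part of the change in
  size has mean at least \<open>\<delta>\<close>. Sizes are integers, so the mean of a concave function of the size drops at
  least as much as if the size moved by \<open>+1\<close> and \<open>-1\<close> with probability \<open>\<delta>\<close> each
  (\<open>avg_concave_le\<close>). For \<open>sin (\<pi> k / n)\<close>, this means decay by the factor
  \<open>1 - 2 \<delta> (1 - cos (\<pi> / n))\<close> per step. Since \<open>k (n - k)\<close> and \<open>sqrt (k (n - k))\<close> are largest, relative
  to the sine, at \<open>k = 1\<close>, where the walk starts, the distances decay at this rate with the prefactors
  \<open>1 - 1/n\<close> and \<open>n - 1\<close>. The eigenvalue bound follows from this decay. The polynomial
  bounds come from following \<open>sqrt (k (n - k))\<close> itself: its mean obeys a differential inequality, which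
  \<open>potential\<close> integrates.

  The drift is \<open>1/d\<close> under the expansion hypothesis, since the lowest threshold yields the whole
  neighbourhood (\<open>drift_of_expansion\<close>). The expansion passes to the reversed walk
  (\<open>expansion_reversed\<close>). For a lazy walk the drift is the flow out of the set
  (\<open>drift_of_heavy_loops\<close>), which is at least \<open>1 / (2 d)\<close> by strong connectivity. The spectral gap depends
  only on the symmetrisation of the walk, so it can be read off the lazy symmetrised walk, whose drift
  also comes from strong connectivity (\<open>quadratic_form_le_of_flow\<close>).
\<close>

section \<open>Powers of transition matrices\<close>

lemma sum_delta_row:
  assumes "finite V" "x \<in> V"
  shows "(\<Sum>z\<in>V. (if x = z then 1 else 0) * f z) = (f x :: real)"
proof -
  have "(\<Sum>z\<in>V. (if x = z then 1 else 0) * f z) = (\<Sum>z\<in>V. if x = z then f z else 0)"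
    by (rule sum.cong) auto
  then show ?thesis using assms by simp
qed

lemma matrix_pow_add:
  assumes "finite V" "x \<in> V"
  shows "matrix_pow V P (s + t) x y = (\<Sum>z\<in>V. matrix_pow V P s x z * matrix_pow V P t z y)"
  using assms(2)
proof (induction s arbitrary: x)
  case 0
  then show ?case using assms(1) by (simp add: sum_delta_row)
next
  case (Suc s)
  have "matrix_pow V P (Suc s + t) x y
      = (\<Sum>w\<in>V. P x w * (\<Sum>z\<in>V. matrix_pow V P s w z * matrix_pow V P t z y))"
    using Suc by simp
  also have "\<dots> = (\<Sum>w\<in>V. \<Sum>z\<in>V. P x w * matrix_pow V P s w z * matrix_pow V P t z y)"
    by (simp add: sum_distrib_left mult.assoc)
  also have "\<dots> = (\<Sum>z\<in>V. \<Sum>w\<in>V. P x w * matrix_pow V P s w z * matrix_pow V P t z y)"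
    by (rule sum.swap)
  finally show ?case by (simp add: sum_distrib_right)
qed

lemma matrix_pow_Suc_right:
  assumes "finite V" "x \<in> V" "y \<in> V"
  shows "matrix_pow V P (Suc t) x y = (\<Sum>z\<in>V. matrix_pow V P t x z * P z y)"
proof -
  have "matrix_pow V P (Suc 0) z y = P z y" if "z \<in> V" for z
  proof -
    have "matrix_pow V P (Suc 0) z y = (\<Sum>w\<in>V. if w = y then P z y else 0)"
      by simp (rule sum.cong, auto)
    then show ?thesis using assms by simp
  qed
  then show ?thesis
    using matrix_pow_add[OF assms(1,2), of P t "Suc 0" y] by simp
qed

lemma matrix_pow_transpose:
  assumes "finite V" "x \<in> V" "y \<in> V"
  shows "matrix_pow V (\<lambda>u v. P v u) t x y = matrix_pow V P t y x"
  using assms(2,3)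
proof (induction t arbitrary: x y)
  case (Suc t)
  have "matrix_pow V (\<lambda>u v. P v u) (Suc t) x y = (\<Sum>z\<in>V. matrix_pow V P t y z * P z x)"
    using Suc by (auto intro!: sum.cong simp: mult.commute)
  then show ?case using matrix_pow_Suc_right[OF assms(1) Suc.prems(2,1)] by simp
qed auto

lemma matrix_pow_row_sum:
  assumes "finite V" "\<And>x. x \<in> V \<Longrightarrow> (\<Sum>y\<in>V. P x y) = 1" "x \<in> V"
  shows "(\<Sum>y\<in>V. matrix_pow V P t x y) = 1"
  using assms(3)
proof (induction t arbitrary: x)
  case (Suc t)
  have "(\<Sum>y\<in>V. matrix_pow V P (Suc t) x y) = (\<Sum>z\<in>V. \<Sum>y\<in>V. P x z * matrix_pow V P t z y)"
    unfolding matrix_pow.simps by (rule sum.swap)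
  also have "\<dots> = (\<Sum>z\<in>V. P x z * 1)"
    unfolding sum_distrib_left[symmetric] using Suc.IH by (intro sum.cong) auto
  finally show ?case using assms(2) Suc.prems by simp
qed (use assms(1) in simp)

section \<open>Inequalities for the sine and for \<open>sqrt (k (n - k))\<close>\<close>

text \<open>
  The function \<open>x (1 - x) / sin (\<pi> x)\<close> decreases on \<open>(0, 1/2]\<close>: the numerator \<open>N\<close> of its derivative
  vanishes at both \<open>0\<close> and \<open>1/2\<close>, and \<open>N'\<close> is negative first and positive afterwards, so \<open>N \<le> 0\<close>.
\<close>

lemma parabola_over_sine_antimono:
  assumes "0 < a" "a \<le> x" "x \<le> 1/2"
  shows "x * (1 - x) * sin (pi * a) \<le> a * (1 - a) * sin (pi * x)"
proof -
  define N where "N = (\<lambda>x. (1 - 2*x) * sin (pi*x) - pi * (x * (1 - x)) * cos (pi*x))"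
  have N': "(N has_real_derivative sin (pi*x) * (pi^2 * (x * (1 - x)) - 2)) (at x)" for x
    unfolding N_def
    by (rule derivative_eq_intros refl | simp)+ (simp add: algebra_simps power2_eq_square)
  have sin_ge: "sin (pi * y) \<ge> 0" if "0 \<le> y" "y \<le> 1/2" for y
    using that by (intro sin_ge_zero) (auto simp: mult_left_le)
  have mono: "y * (1 - y) \<le> z * (1 - z)" if "y \<le> z" "z \<le> 1/2" for y z :: real
  proof -
    have "z * (1 - z) - y * (1 - y) = (z - y) * (1 - y - z)" by algebra
    moreover have "(z - y) * (1 - y - z) \<ge> 0" using that by (intro mult_nonneg_nonneg) auto
    ultimately show ?thesis by linarith
  qed
  have N_le: "N y \<le> 0" if y: "0 \<le> y" "y \<le> 1/2" for y
  proof (cases "pi^2 * (y * (1 - y)) \<le> 2")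
    case True
    have "N y \<le> N 0"
    proof (rule DERIV_nonpos_imp_nonincreasing[OF y(1)])
      fix u assume u: "0 \<le> u" "u \<le> y"
      have "pi^2 * (u * (1 - u)) \<le> pi^2 * (y * (1 - y))"
        using mono[of u y] u y by (intro mult_left_mono) auto
      then have "sin (pi*u) * (pi^2 * (u * (1 - u)) - 2) \<le> 0"
        using True sin_ge[of u] u y by (intro mult_nonneg_nonpos) linarith+
      then show "\<exists>D. (N has_real_derivative D) (at u) \<and> D \<le> 0" using N' by blast
    qed
    then show ?thesis by (simp add: N_def)
  next
    case False
    have "N y \<le> N (1/2)"
    proof (rule DERIV_nonneg_imp_nondecreasing[OF y(2)])
      fix u assume u: "y \<le> u" "u \<le> 1/2"
      have "pi^2 * (y * (1 - y)) \<le> pi^2 * (u * (1 - u))"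
        using mono[of y u] u y by (intro mult_left_mono) auto
      then have "sin (pi*u) * (pi^2 * (u * (1 - u)) - 2) \<ge> 0"
        using False sin_ge[of u] u y by (intro mult_nonneg_nonneg) linarith+
      then show "\<exists>D. (N has_real_derivative D) (at u) \<and> D \<ge> 0" using N' by blast
    qed
    then show ?thesis by (simp add: N_def)
  qed
  have pos: "sin (pi * y) > 0" if "a \<le> y" "y \<le> x" for y
  proof (rule sin_gt_zero)
    show "pi * y < pi" using that assms by simp
  qed (use that assms in auto)
  have "x * (1 - x) / sin (pi * x) \<le> a * (1 - a) / sin (pi * a)"
  proof (rule DERIV_nonpos_imp_nonincreasing[OF assms(2)])
    fix y assume y: "a \<le> y" "y \<le> x"
    have "((\<lambda>y. y * (1 - y) / sin (pi * y)) has_real_derivative N y / (sin (pi*y))\<^sup>2) (at y)"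
      unfolding N_def using pos[OF y]
      by (auto intro!: derivative_eq_intros simp: field_simps power2_eq_square)
    moreover have "N y / (sin (pi*y))\<^sup>2 \<le> 0"
      using N_le[of y] y assms by (intro divide_nonpos_nonneg) auto
    ultimately show "\<exists>D. ((\<lambda>y. y * (1 - y) / sin (pi * y)) has_real_derivative D) (at y) \<and> D \<le> 0"
      by blast
  qed
  then show ?thesis using pos[of a] pos[of x] assms by (simp add: field_simps)
qed

text \<open>
  Among the set sizes \<open>0 < k < n\<close>, singletons are the worst case when \<open>k (n - k)\<close> is estimated by a
  multiple of \<open>sin (\<pi> k / n)\<close>. A walk starts from a singleton, so passing from the sine to
  \<open>k (n - k)\<close> and back costs nothing at time \<open>0\<close>.
\<close>

lemma sin_multiple_bounds:
  fixes n k :: nat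
  assumes "0 < k" "k < n"
  shows "real k * (real n - real k) * sin (pi / n) \<le> (real n - 1) * sin (pi * k / n)"
    and "sin (pi / n) \<le> sin (pi * k / n)" and "sin (pi / n) > 0"
proof -
  have main: "real k * (real n - real k) * sin (pi / n) \<le> (real n - 1) * sin (pi * k / n)
      \<and> sin (pi / n) \<le> sin (pi * k / n)" if k: "0 < k" "2 * k \<le> n" for k
  proof -
    have n: "real n > 0" using k by simp
    have "(k/n) * (1 - k/n) * sin (pi * (1/n)) \<le> (1/n) * (1 - 1/n) * sin (pi * (k/n))"
      using k by (intro parabola_over_sine_antimono) (auto simp: field_simps)
    then have "real n ^ 2 * ((k/n) * (1 - k/n) * sin (pi * (1/n)))
        \<le> real n ^ 2 * ((1/n) * (1 - 1/n) * sin (pi * (k/n)))"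
      by (intro mult_left_mono) auto
    moreover have "real n ^ 2 * ((k/n) * (1 - k/n)) = real k * (real n - real k)"
      "real n ^ 2 * ((1/n) * (1 - 1/n)) = real n - 1"
      using n by (auto simp: field_simps power2_eq_square)
    ultimately have "real k * (real n - real k) * sin (pi / n) \<le> (real n - 1) * sin (pi * k / n)"
      by (metis mult.assoc mult.right_neutral times_divide_eq_right)
    moreover have "sin (pi / n) \<le> sin (pi * k / n)"
    proof (subst sin_mono_le_eq)
      have "real 2 * real k \<le> real n" using k by (metis of_nat_le_iff of_nat_mult)
      then have "real k / real n \<le> 1/2" using n by (simp add: field_simps)
      then have "pi * (k / n) \<le> pi * (1/2)" by (intro mult_left_mono) auto
      then show "pi * k / n \<le> pi / 2" by simp
      show le: "pi / n \<le> pi * k / n" using k n by (intro divide_right_mono) auto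
      show "- (pi/2) \<le> pi / n" "- (pi/2) \<le> pi * k / n"
        by (auto intro: order_trans[of _ 0])
      show "pi / n \<le> pi / 2" using le \<open>pi * k / n \<le> pi / 2\<close> by linarith
    qed
    ultimately show ?thesis by blast
  qed
  have "real k * (real n - real k) * sin (pi / n) \<le> (real n - 1) * sin (pi * k / n)
      \<and> sin (pi / n) \<le> sin (pi * k / n)"
  proof (cases "2 * k \<le> n")
    case True then show ?thesis using main assms by blast
  next
    case False
    have "sin (pi * real (n - k) / n) = sin (pi - pi * k / n)"
      using assms by (simp add: field_simps of_nat_diff)
    then have "sin (pi * real (n - k) / n) = sin (pi * k / n)" by simp
    then show ?thesis
      using main[of "n - k"] False assms by (simp add: of_nat_diff mult.commute)
  qed
  then show "real k * (real n - real k) * sin (pi / n) \<le> (real n - 1) * sin (pi * k / n)"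
    "sin (pi / n) \<le> sin (pi * k / n)" by auto
  show "sin (pi / n) > 0" using assms by (intro sin_gt_zero) (auto simp: field_simps)
qed

text \<open>
  The cubic is the Taylor polynomial at \<open>0\<close>, so its square and \<open>1 + x\<close> differ only from the fourth order
  on, and the difference is nonnegative.
\<close>

lemma sqrt_le_cubic:
  fixes x :: real
  assumes "x \<ge> -1"
  shows "sqrt (1 + x) \<le> 1 + x/2 - x^2/8 + x^3/16"
proof (rule real_le_lsqrt)
  have "(1 + x/2 - x^2/8 + x^3/16)^2 - (1 + x) = x^4/256 * ((x - 2)^2 + 16)"
    by (simp add: field_simps power2_eq_square power3_eq_cube power4_eq_xxxx)
  moreover have "x^4/256 * ((x - 2)^2 + 16) \<ge> 0"
    by (intro mult_nonneg_nonneg) auto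
  ultimately show "1 + x \<le> (1 + x/2 - x^2/8 + x^3/16)^2" by linarith
  have "1 + x/2 - x^2/8 + x^3/16 = ((x+1)*((x - 3/2)^2 + 35/4) + 5) / 16"
    by (simp add: field_simps power2_eq_square power3_eq_cube)
  also have "\<dots> \<ge> 0" using assms
    by (intro divide_nonneg_pos add_nonneg_nonneg[OF mult_nonneg_nonneg]) auto
  finally show "0 \<le> 1 + x/2 - x^2/8 + x^3/16" .
qed

text \<open>
  A discrete form of \<open>\<phi>'' = - n^2 / (4 \<phi>^3)\<close> for \<open>\<phi>(k) = sqrt (k (n - k))\<close>. Divide by \<open>\<phi>(k)\<close> and use
  the cubic bound on both neighbours; the cubic terms and the surplus of the quadratic ones are negative.
\<close>

lemma sqrt_second_difference:
  fixes n k :: nat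
  assumes k: "0 < k" "k < n"
  shows "sqrt (real (k+1) * (real n - real (k+1))) + sqrt (real (k-1) * (real n - real (k-1)))
      \<le> 2 * sqrt (real k * (real n - real k)) - n^2 / (4 * (sqrt (real k * (real n - real k)))^3)"
proof -
  define a where "a = real k"
  define m where "m = real n"
  define v where "v = a * (m - a)"
  define x where "x = (m - 2*a - 1) / v"
  define y where "y = (- (m - 2*a) - 1) / v"
  have am: "a \<ge> 1" "m - a \<ge> 1" using k by (auto simp: a_def m_def)
  have v: "v > 0" unfolding v_def using am by simp
  have "1 + x = (v + (m - 2*a - 1)) / v" "1 + y = (v + (- (m - 2*a) - 1)) / v"
    using v by (auto simp: x_def y_def add_divide_distrib)
  then have x1: "1 + x = (a+1) * (m - (a+1)) / v" and y1: "1 + y = (a-1) * (m - (a-1)) / v"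
    by (auto simp: v_def algebra_simps)
  have "x \<ge> -1" "y \<ge> -1"
    using x1 y1 am v by (smt (verit) divide_nonneg_pos mult_nonneg_nonneg)+
  then have "sqrt (1+x) + sqrt (1+y) \<le> (1 + x/2 - x^2/8 + x^3/16) + (1 + y/2 - y^2/8 + y^3/16)"
    by (intro add_mono sqrt_le_cubic)
  also have "\<dots> = 2 - m^2 / (4 * v^2) - (1 / (4*v^2) + (1 + 3 * (m - 2*a)^2) / (8 * v^3))"
  proof -
    have s: "x + y = - 2 / v" "x^2 + y^2 = 2 * ((m-2*a)^2 + 1) / v^2"
      "x^3 + y^3 = - 2 * (1 + 3 * (m-2*a)^2) / v^3"
      using v by (auto simp: x_def y_def field_simps power2_eq_square power3_eq_cube)
    have "(1 + x/2 - x^2/8 + x^3/16) + (1 + y/2 - y^2/8 + y^3/16)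
        = 2 + (x+y)/2 - (x^2+y^2)/8 + (x^3+y^3)/16" by (simp add: field_simps)
    also have "\<dots> = 2 - 1 / v - ((m-2*a)^2 + 1) / (4 * v^2) - (1 + 3 * (m-2*a)^2) / (8 * v^3)"
      unfolding s using v by (simp add: field_simps power2_eq_square power3_eq_cube)
    also have "1 / v = 4 * v / (4 * v^2)" using v by (simp add: field_simps power2_eq_square)
    also have "2 - 4 * v / (4 * v^2) - ((m-2*a)^2 + 1) / (4 * v^2) - (1 + 3 * (m-2*a)^2) / (8 * v^3)
        = 2 - (4*v + (m-2*a)^2) / (4 * v^2) - (1 / (4*v^2) + (1 + 3 * (m - 2*a)^2) / (8 * v^3))"
      by (simp add: add_divide_distrib)
    also have "4*v + (m-2*a)^2 = m^2" by (simp add: v_def power2_eq_square algebra_simps)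
    finally show ?thesis .
  qed
  also have "\<dots> \<le> 2 - m^2 / (4 * v^2)"
  proof -
    have "1 / (4*v^2) + (1 + 3 * (m - 2*a)^2) / (8 * v^3) \<ge> 0"
      using v by (intro add_nonneg_nonneg divide_nonneg_nonneg) auto
    then show ?thesis by linarith
  qed
  finally have "sqrt v * (sqrt (1+x) + sqrt (1+y)) \<le> sqrt v * (2 - m^2 / (4 * v^2))"
    using v by (intro mult_left_mono) auto
  moreover have "sqrt v * sqrt (1+x) = sqrt ((a+1) * (m - (a+1)))"
    "sqrt v * sqrt (1+y) = sqrt ((a-1) * (m - (a-1)))"
    using v by (simp_all add: x1 y1 flip: real_sqrt_mult)
  moreover have "sqrt v * (2 - m^2 / (4 * v^2)) = 2 * sqrt v - m^2 / (4 * (sqrt v)^3)"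
  proof -
    have "v^2 = sqrt v * (sqrt v)^3"
      using v by (simp add: power2_eq_square power3_eq_cube flip: mult.assoc)
    then show ?thesis using v by (simp add: field_simps)
  qed
  moreover have "real (k - 1) = a - 1" using k by (simp add: a_def of_nat_diff)
  ultimately show ?thesis
    by (simp add: a_def m_def v_def distrib_left add.commute)
qed

lemma concave_seq_le_tangent:
  fixes g :: "nat \<Rightarrow> real"
  assumes conc: "\<And>i. 0 < i \<Longrightarrow> i < n \<Longrightarrow> g (i+1) + g (i-1) \<le> 2 * g i"
    and k: "0 < k" "k < n" and m: "m \<le> n"
  shows "g m \<le> g k + real (m - k) * (g (k+1) - g k) + real (k - m) * (g (k-1) - g k)"
proof -
  have up: "k + i \<le> n \<Longrightarrow> g (k+i) \<le> g k + real i * (g (k+1) - g k)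
      \<and> (k + i < n \<longrightarrow> g (k+i+1) - g (k+i) \<le> g (k+1) - g k)" for i
  proof (induction i)
    case (Suc i)
    then have *: "g (k+i) \<le> g k + real i * (g (k+1) - g k)" "g (k+i+1) - g (k+i) \<le> g (k+1) - g k"
      by auto
    show ?case using * conc[of "k + Suc i"] by (auto simp: algebra_simps)
  qed auto
  have down: "i \<le> k \<Longrightarrow> g (k-i) \<le> g k + real i * (g (k-1) - g k)
      \<and> (i < k \<longrightarrow> g (k-i-1) - g (k-i) \<le> g (k-1) - g k)" for i
  proof (induction i)
    case (Suc i)
    then have *: "g (k-i) \<le> g k + real i * (g (k-1) - g k)" "g (k-i-1) - g (k-i) \<le> g (k-1) - g k"
      by auto
    have "k - i - 1 = k - Suc i" "k - Suc i + 1 = k - i" using Suc.prems by auto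
    moreover have "k - Suc i < n" using k by linarith
    ultimately show ?case using * conc[of "k - Suc i"]
      by (cases "Suc i < k") (auto simp: algebra_simps)
  qed auto
  show ?thesis
  proof (cases "k \<le> m")
    case True then show ?thesis using up[of "m - k"] m by simp
  next
    case False then show ?thesis using down[of "k - m"] by simp
  qed
qed


section \<open>Evolving sets\<close>

lemma L2_set_sum_le: "L2_set (\<lambda>y. \<Sum>j\<in>J. f j y) V \<le> (\<Sum>j\<in>J. L2_set (f j) V)"
proof (induction J rule: infinite_finite_induct)
  case (insert j J)
  then show ?case
    using L2_set_triangle_ineq[of "f j" "\<lambda>y. \<Sum>j\<in>J. f j y" V] by simp
qed (simp_all add: L2_set_def)

text \<open>
  A doubly stochastic matrix with denominator \<open>D\<close>. For a set \<open>A\<close>, \<open>inflow A y / D\<close> is the probability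
  flow from \<open>A\<close> into \<open>y\<close>; the evolving set process moves from \<open>A\<close> to the set of all \<open>y\<close> for which this
  flow is at least a uniform random threshold. All flows are multiples of \<open>1/D\<close>, so a threshold
  drawn from \<open>{1..D}\<close> has the same effect as one drawn from \<open>[0, 1]\<close>.
\<close>

locale biregular =
  fixes V :: "'a set" and W :: "'a \<Rightarrow> 'a \<Rightarrow> nat" and D :: nat
  assumes finite_V: "finite V" and D_pos: "D > 0"
    and row_sum: "x \<in> V \<Longrightarrow> (\<Sum>y\<in>V. W x y) = D"
    and col_sum: "y \<in> V \<Longrightarrow> (\<Sum>x\<in>V. W x y) = D"
begin

definition kernel :: "'a \<Rightarrow> 'a \<Rightarrow> real" where
  "kernel x y = real (W x y) / real D"

definition inflow :: "'a set \<Rightarrow> 'a \<Rightarrow> nat" where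
  "inflow A y = (\<Sum>x\<in>A. W x y)"

definition level :: "'a set \<Rightarrow> nat \<Rightarrow> 'a set" where
  "level A j = {y \<in> V. j \<le> inflow A y}"

text \<open>
  The transition operator of the evolving set process: its power \<open>(avg ^^ t) F A\<close> is the expectation
  of \<open>F\<close> after \<open>t\<close> steps from \<open>A\<close>.
\<close>

definition avg :: "('a set \<Rightarrow> real) \<Rightarrow> 'a set \<Rightarrow> real" where
  "avg F A = (\<Sum>j=1..D. F (level A j)) / real D"

lemma level_subset: "level A j \<subseteq> V"
  by (auto simp: level_def)

lemma finite_subset_V: "A \<subseteq> V \<Longrightarrow> finite A"
  using finite_V finite_subset by blast

lemma card_le_V: "A \<subseteq> V \<Longrightarrow> card A \<le> card V"
  using finite_V card_mono by blast

lemma inflow_le: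
  assumes "A \<subseteq> V" "y \<in> V"
  shows "inflow A y \<le> D"
  using sum_mono2[OF finite_V assms(1), of "\<lambda>x. W x y"] col_sum[OF assms(2)]
  by (simp add: inflow_def)

lemma inflow_complement:
  assumes "A \<subseteq> V" "y \<in> V"
  shows "inflow (V - A) y + inflow A y = D"
  using sum.subset_diff[OF assms(1) finite_V, of "\<lambda>x. W x y"] col_sum[OF assms(2)]
  by (simp add: inflow_def)

lemma sum_inflow: "A \<subseteq> V \<Longrightarrow> (\<Sum>y\<in>V. inflow A y) = card A * D"
  unfolding inflow_def by (subst sum.swap) (simp add: row_sum subset_iff)

text \<open>
  A state \<open>y\<close> belongs to exactly \<open>inflow A y\<close> of the \<open>D\<close> sets \<open>level A j\<close>.
\<close>

lemma sum_levels:
  fixes f :: "'a \<Rightarrow> real"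
  assumes "A \<subseteq> V"
  shows "(\<Sum>j=1..D. \<Sum>y\<in>level A j. f y) = (\<Sum>y\<in>V. real (inflow A y) * f y)"
proof -
  have "(\<Sum>j=1..D. \<Sum>y\<in>level A j. f y) = (\<Sum>j=1..D. \<Sum>y\<in>V. if j \<le> inflow A y then f y else 0)"
    unfolding level_def using finite_V by (simp add: sum.inter_filter)
  also have "\<dots> = (\<Sum>y\<in>V. \<Sum>j=1..D. if j \<le> inflow A y then f y else 0)"
    by (rule sum.swap)
  also have "\<dots> = (\<Sum>y\<in>V. real (inflow A y) * f y)"
  proof (rule sum.cong[OF refl])
    fix y assume "y \<in> V"
    then have "{j \<in> {1..D}. j \<le> inflow A y} = {1..inflow A y}"
      using inflow_le[OF assms] by fastforce
    then show "(\<Sum>j=1..D. if j \<le> inflow A y then f y else 0) = real (inflow A y) * f y"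
      by (simp flip: sum.inter_filter)
  qed
  finally show ?thesis .
qed

lemma sum_card_levels:
  assumes "A \<subseteq> V"
  shows "(\<Sum>j=1..D. real (card (level A j))) = real D * real (card A)"
  using sum_levels[OF assms, of "\<lambda>_. 1"] sum_inflow[OF assms]
  by (simp flip: of_nat_sum)

lemma level_empty: "1 \<le> j \<Longrightarrow> level {} j = {}"
  by (auto simp: level_def inflow_def)

lemma level_V: "j \<le> D \<Longrightarrow> level V j = V"
  by (auto simp: level_def inflow_def col_sum)

lemma avg_trivial: "A = {} \<or> A = V \<Longrightarrow> avg F A = F A"
  using D_pos level_empty level_V by (auto simp: avg_def)

lemma avg_mono:
  assumes "\<And>S. S \<subseteq> V \<Longrightarrow> F S \<le> H S"
  shows "avg F A \<le> avg H A"
  unfolding avg_def by (intro divide_right_mono sum_mono assms level_subset) simp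

lemma evolve_Suc: "(avg ^^ Suc t) F A = (\<Sum>j=1..D. (avg ^^ t) F (level A j)) / real D"
  by (simp add: avg_def[of "(avg ^^ t) F"])

lemma evolve_mono:
  assumes "\<And>S. S \<subseteq> V \<Longrightarrow> F S \<le> H S" "A \<subseteq> V"
  shows "(avg ^^ t) F A \<le> (avg ^^ t) H A"
  using assms(2) by (induction t arbitrary: A) (auto intro: avg_mono assms(1))

lemma evolve_cong:
  assumes "\<And>S. S \<subseteq> V \<Longrightarrow> F S = H S" "A \<subseteq> V"
  shows "(avg ^^ t) F A = (avg ^^ t) H A"
  using evolve_mono[of F H] evolve_mono[of H F] assms by (simp add: antisym)

lemma avg_linear: "avg (\<lambda>S. a * F S + b * H S) A = a * avg F A + b * avg H A"
  by (simp add: avg_def sum.distrib sum_distrib_left add_divide_distrib)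

lemma evolve_linear:
  "(avg ^^ t) (\<lambda>S. a * F S + b * H S) A = a * (avg ^^ t) F A + b * (avg ^^ t) H A"
proof (induction t arbitrary: A)
  case (Suc t)
  then have "(avg ^^ t) (\<lambda>S. a * F S + b * H S) = (\<lambda>S. a * (avg ^^ t) F S + b * (avg ^^ t) H S)"
    by blast
  then show ?case by (simp add: avg_linear)
qed simp

lemma evolve_scale: "(avg ^^ t) (\<lambda>S. a * F S) A = a * (avg ^^ t) F A"
  using evolve_linear[of t a F 0 F A] by simp

text \<open>
  The size of the evolving set is a martingale, because the columns of \<open>W\<close> have the same sum as its
  rows.
\<close>

lemma evolve_card: "A \<subseteq> V \<Longrightarrow> (avg ^^ t) (\<lambda>S. real (card S)) A = real (card A)"
proof (induction t arbitrary: A)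
  case (Suc t)
  then have "(avg ^^ Suc t) (\<lambda>S. real (card S)) A = (\<Sum>j=1..D. real (card (level A j))) / real D"
    by (simp only: evolve_Suc level_subset)
  then show ?case using D_pos sum_card_levels[OF Suc.prems] by simp
qed simp

text \<open>
  Duality: \<open>y\<close> is in the evolving set after \<open>t\<close> steps from \<open>{x}\<close> with probability \<open>P^t(x, y)\<close>.
  Both sides obey the same recursion in \<open>t\<close>, by \<open>sum_levels\<close>.
\<close>

lemma matrix_pow_eq_evolve:
  assumes "A \<subseteq> V" "y \<in> V"
  shows "(\<Sum>x\<in>A. matrix_pow V kernel t x y) = (avg ^^ t) (\<lambda>S. if y \<in> S then 1 else 0) A"
  using assms(1)
proof (induction t arbitrary: A)
  case 0
  then show ?case using finite_subset_V[OF 0] by simp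
next
  case (Suc t)
  have "(\<Sum>x\<in>A. matrix_pow V kernel (Suc t) x y)
      = (\<Sum>z\<in>V. (\<Sum>x\<in>A. kernel x z) * matrix_pow V kernel t z y)"
    by (simp add: sum_distrib_right) (rule sum.swap)
  also have "\<dots> = (\<Sum>z\<in>V. real (inflow A z) * matrix_pow V kernel t z y) / real D"
    by (simp add: kernel_def inflow_def flip: sum_divide_distrib)
  also have "\<dots> = (\<Sum>j=1..D. \<Sum>z\<in>level A j. matrix_pow V kernel t z y) / real D"
    by (simp only: sum_levels[OF Suc.prems])
  also have "\<dots> = (avg ^^ Suc t) (\<lambda>S. if y \<in> S then 1 else 0) A"
    by (simp only: evolve_Suc Suc.IH level_subset)
  finally show ?case .
qed

text \<open>
  With the martingale property, the deviation from uniformity becomes the expectation of the same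
  quantity for a deterministic set, so that convexity of a norm applies.
\<close>

lemma matrix_pow_deviation:
  assumes "x \<in> V" "y \<in> V"
  shows "matrix_pow V kernel t x y - 1 / real (card V)
    = (avg ^^ t) (\<lambda>S. (if y \<in> S then 1 else 0) - real (card S) / real (card V)) {x}"
proof -
  have "(avg ^^ t) (\<lambda>S. 1 * (if y \<in> S then 1 else 0) + (- 1 / real (card V)) * real (card S)) {x}
      = matrix_pow V kernel t x y - 1 / real (card V)"
    unfolding evolve_linear using matrix_pow_eq_evolve[of "{x}" y t] evolve_card[of "{x}" t] assms
    by simp
  then show ?thesis by simp
qed

lemma evolve_L2_le:
  "L2_set (\<lambda>y. (avg ^^ t) (F y) A) V \<le> (avg ^^ t) (\<lambda>S. L2_set (\<lambda>y. F y S) V) A"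
proof (induction t arbitrary: A)
  case (Suc t)
  have "L2_set (\<lambda>y. (avg ^^ Suc t) (F y) A) V
      = L2_set (\<lambda>y. (1 / real D) * (\<Sum>j=1..D. (avg ^^ t) (F y) (level A j))) V"
    by (simp add: evolve_Suc del: funpow.simps)
  also have "\<dots> = (1 / real D) * L2_set (\<lambda>y. \<Sum>j=1..D. (avg ^^ t) (F y) (level A j)) V"
    by (rule L2_set_right_distrib[symmetric]) simp
  also have "\<dots> \<le> (1 / real D) * (\<Sum>j=1..D. L2_set (\<lambda>y. (avg ^^ t) (F y) (level A j)) V)"
    by (intro mult_left_mono L2_set_sum_le) simp
  also have "\<dots> \<le> (1 / real D) * (\<Sum>j=1..D. (avg ^^ t) (\<lambda>S. L2_set (\<lambda>y. F y S) V) (level A j))"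
    by (intro mult_left_mono sum_mono Suc.IH) simp
  also have "\<dots> = (avg ^^ Suc t) (\<lambda>S. L2_set (\<lambda>y. F y S) V) A"
    by (simp add: evolve_Suc del: funpow.simps)
  finally show ?case .
qed simp

lemma evolve_L1_le:
  assumes "A \<subseteq> V"
  shows "(\<Sum>y\<in>V. \<bar>(avg ^^ t) (F y) A\<bar>) \<le> (avg ^^ t) (\<lambda>S. \<Sum>y\<in>V. \<bar>F y S\<bar>) A"
  using assms
proof (induction t arbitrary: A)
  case (Suc t)
  have "(\<Sum>y\<in>V. \<bar>(avg ^^ Suc t) (F y) A\<bar>)
      \<le> (\<Sum>y\<in>V. (\<Sum>j=1..D. \<bar>(avg ^^ t) (F y) (level A j)\<bar>) / real D)"
    by (auto simp: evolve_Suc abs_divide simp del: funpow.simps intro!: sum_mono divide_right_mono)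
  also have "\<dots> = (\<Sum>j=1..D. \<Sum>y\<in>V. \<bar>(avg ^^ t) (F y) (level A j)\<bar>) / real D"
    unfolding sum_divide_distrib[symmetric] by (subst sum.swap) simp
  also have "\<dots> \<le> (\<Sum>j=1..D. (avg ^^ t) (\<lambda>S. \<Sum>y\<in>V. \<bar>F y S\<bar>) (level A j)) / real D"
    by (intro divide_right_mono sum_mono Suc.IH level_subset) simp
  also have "\<dots> = (avg ^^ Suc t) (\<lambda>S. \<Sum>y\<in>V. \<bar>F y S\<bar>) A"
    by (simp add: evolve_Suc del: funpow.simps)
  finally show ?case .
qed simp

lemma sum_indicator_values:
  fixes a b :: real
  assumes "S \<subseteq> V"
  shows "(\<Sum>y\<in>V. if y \<in> S then a else b) = card S * a + (real (card V) - card S) * b"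
proof -
  have "(\<Sum>y\<in>V. if y \<in> S then a else b) = (\<Sum>y\<in>S. a) + (\<Sum>y\<in>V - S. b)"
    using sum.subset_diff[OF assms finite_V, of "\<lambda>y. if y \<in> S then a else b"] by simp
  then show ?thesis
    using card_Diff_subset[OF finite_subset_V[OF assms] assms] card_le_V[OF assms] by simp
qed

lemma tv_dist_le_evolve:
  assumes "x \<in> V"
  shows "tv_dist V (uniform_dist V) kernel t x
    \<le> (avg ^^ t) (\<lambda>S. real (card S) * (real (card V) - card S)) {x} / card V"
proof -
  define n where "n = real (card V)"
  have n: "n > 0" using assms finite_V by (auto simp: n_def card_gt_0_iff)
  have "tv_dist V (uniform_dist V) kernel t x
      = 1/2 * (\<Sum>y\<in>V. \<bar>(avg ^^ t) (\<lambda>S. (if y \<in> S then 1 else 0) - real (card S) / n) {x}\<bar>)"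
    by (simp add: tv_dist_def uniform_dist_def n_def matrix_pow_deviation[OF assms])
  also have "\<dots> \<le> 1/2 * (avg ^^ t) (\<lambda>S. \<Sum>y\<in>V. \<bar>(if y \<in> S then 1 else 0) - real (card S) / n\<bar>) {x}"
    using assms by (intro mult_left_mono evolve_L1_le) auto
  also have "(avg ^^ t) (\<lambda>S. \<Sum>y\<in>V. \<bar>(if y \<in> S then 1 else 0) - real (card S) / n\<bar>) {x}
      = (avg ^^ t) (\<lambda>S. (2 / n) * (real (card S) * (n - card S))) {x}"
  proof (rule evolve_cong)
    fix S assume S: "S \<subseteq> V"
    have le: "real (card S) \<le> n" using card_le_V[OF S] by (simp add: n_def)
    have "(\<Sum>y\<in>V. \<bar>(if y \<in> S then 1 else 0) - real (card S) / n\<bar>)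
        = (\<Sum>y\<in>V. if y \<in> S then 1 - real (card S) / n else real (card S) / n)"
      using le n by (intro sum.cong) (auto simp: field_simps)
    then show "(\<Sum>y\<in>V. \<bar>(if y \<in> S then 1 else 0) - real (card S) / n\<bar>)
        = (2 / n) * (real (card S) * (n - card S))"
      using n by (simp add: sum_indicator_values[OF S] flip: n_def) (simp add: field_simps)
  qed (use assms in simp)
  finally show ?thesis unfolding evolve_scale by (simp add: n_def)
qed

text \<open>
  Up to scaling, the standard deviation of the indicator function of \<open>S\<close> under the uniform distribution.
\<close>

definition spread :: "'a set \<Rightarrow> real" where
  "spread S = sqrt (real (card S) * (real (card V) - card S))"

lemma L2_dist_le_evolve:
  assumes "x \<in> V"
  shows "L2_set (\<lambda>y. matrix_pow V kernel t x y - 1 / real (card V)) V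
    \<le> (avg ^^ t) spread {x} / sqrt (card V)"
proof -
  define n where "n = real (card V)"
  have n: "n > 0" using assms finite_V by (auto simp: n_def card_gt_0_iff)
  have "L2_set (\<lambda>y. matrix_pow V kernel t x y - 1 / real (card V)) V
      = L2_set (\<lambda>y. (avg ^^ t) (\<lambda>S. (if y \<in> S then 1 else 0) - real (card S) / n) {x}) V"
    by (rule L2_set_cong) (simp_all add: n_def matrix_pow_deviation[OF assms])
  also have "\<dots> \<le> (avg ^^ t) (\<lambda>S. L2_set (\<lambda>y. (if y \<in> S then 1 else 0) - real (card S) / n) V) {x}"
    by (rule evolve_L2_le)
  also have "\<dots> = (avg ^^ t) (\<lambda>S. (1 / sqrt n) * spread S) {x}"
  proof (rule evolve_cong)
    fix S assume S: "S \<subseteq> V"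
    have "(\<Sum>y\<in>V. ((if y \<in> S then 1 else 0) - real (card S) / n)\<^sup>2)
        = (\<Sum>y\<in>V. if y \<in> S then (1 - real (card S) / n)\<^sup>2 else (real (card S) / n)\<^sup>2)"
      by (intro sum.cong) auto
    also have "\<dots> = real (card S) * (n - card S) / n"
      using n by (simp add: sum_indicator_values[OF S] flip: n_def)
        (simp add: field_simps power2_eq_square)
    finally show "L2_set (\<lambda>y. (if y \<in> S then 1 else 0) - real (card S) / n) V
        = (1 / sqrt n) * spread S"
      by (simp add: L2_set_def spread_def n_def real_sqrt_divide)
  qed (use assms in simp)
  finally show ?thesis unfolding evolve_scale by (simp add: n_def)
qed

lemma transpose: "biregular V (\<lambda>x y. W y x) D"
  by unfold_locales (auto simp: finite_V D_pos row_sum col_sum)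

lemma kernel_row_sum: "x \<in> V \<Longrightarrow> (\<Sum>y\<in>V. kernel x y) = 1"
  using row_sum[of x] D_pos by (simp add: kernel_def flip: sum_divide_distrib of_nat_sum)

lemma kernel_column_sum: "y \<in> V \<Longrightarrow> (\<Sum>x\<in>V. kernel x y) = 1"
  using col_sum[of y] D_pos by (simp add: kernel_def flip: sum_divide_distrib of_nat_sum)

lemma matrix_pow_kernel_row_sum: "x \<in> V \<Longrightarrow> (\<Sum>y\<in>V. matrix_pow V kernel t x y) = 1"
  using matrix_pow_row_sum[OF finite_V kernel_row_sum] .

end

text \<open>
  Splitting time as \<open>s + r\<close>, the centred entry \<open>P^(s+r)(x, y) - 1/n\<close> is an inner product of a centred row
  of \<open>P^s\<close> with a centred row of the \<open>r\<close>-th power of the transpose. The Cauchy-Schwarz inequality and the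
  \<open>L2\<close> bound, applied to the walk and to its reversal, give the product.
\<close>

lemma linf_dist_le_spread:
  fixes W :: "'a \<Rightarrow> 'a \<Rightarrow> nat"
  assumes bireg: "biregular V W D" and x: "x \<in> V"
    and fwd: "(biregular.avg V W D ^^ s) (biregular.spread V) {x} \<le> a"
    and bwd: "\<And>y. y \<in> V \<Longrightarrow>
      (biregular.avg V (\<lambda>x y. W y x) D ^^ r) (biregular.spread V) {y} \<le> b"
  shows "linf_dist V (uniform_dist V) (biregular.kernel W D) (s + r) x \<le> a * b"
proof -
  interpret fw: biregular V W D by fact
  interpret bw: biregular V "\<lambda>x y. W y x" D by (rule fw.transpose)
  define n where "n = real (card V)"
  have n: "n > 0" using x fw.finite_V by (auto simp: n_def card_gt_0_iff)
  let ?P = "fw.kernel"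
  have tr: "bw.kernel = (\<lambda>u v. ?P v u)"
    by (simp add: fw.kernel_def bw.kernel_def fun_eq_iff)
  have "\<bar>matrix_pow V ?P (s + r) x y / uniform_dist V y - 1\<bar> \<le> a * b" if y: "y \<in> V" for y
  proof -
    have pow_r: "matrix_pow V ?P r z y = matrix_pow V bw.kernel r y z" if "z \<in> V" for z
      unfolding tr using matrix_pow_transpose[OF fw.finite_V y that] by simp
    let ?f = "\<lambda>z. matrix_pow V ?P s x z - 1 / n"
    let ?g = "\<lambda>z. matrix_pow V bw.kernel r y z - 1 / n"
    have "(\<Sum>z\<in>V. ?f z * ?g z) = (\<Sum>z\<in>V. matrix_pow V ?P s x z * matrix_pow V bw.kernel r y z)
        - (\<Sum>z\<in>V. matrix_pow V ?P s x z) / n - (\<Sum>z\<in>V. matrix_pow V bw.kernel r y z) / n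
        + n * (1 / n * (1 / n))"
      by (simp add: algebra_simps sum.distrib sum_subtractf sum_divide_distrib n_def)
    also have "\<dots> = matrix_pow V ?P (s + r) x y - 1 / n"
      using n by (simp add: fw.matrix_pow_kernel_row_sum bw.matrix_pow_kernel_row_sum x y
          matrix_pow_add[OF fw.finite_V x] pow_r)
    finally have "\<bar>matrix_pow V ?P (s + r) x y - 1 / n\<bar> = \<bar>\<Sum>z\<in>V. ?f z * ?g z\<bar>" by simp
    also have "\<dots> \<le> (\<Sum>z\<in>V. \<bar>?f z\<bar> * \<bar>?g z\<bar>)"
      by (rule order_trans[OF sum_abs]) (simp add: abs_mult)
    also have "\<dots> \<le> L2_set ?f V * L2_set ?g V" by (rule L2_set_mult_ineq)
    also have "\<dots> \<le> (a / sqrt n) * (b / sqrt n)"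
    proof (rule mult_mono)
      have "L2_set ?f V \<le> (fw.avg ^^ s) fw.spread {x} / sqrt n"
        using fw.L2_dist_le_evolve[OF x, of s] by (simp add: n_def)
      also have "\<dots> \<le> a / sqrt n" using fwd n by (intro divide_right_mono) auto
      finally show a: "L2_set ?f V \<le> a / sqrt n" .
      have "L2_set ?g V \<le> (bw.avg ^^ r) bw.spread {y} / sqrt n"
        using bw.L2_dist_le_evolve[OF y, of r] by (simp add: n_def)
      also have "\<dots> \<le> b / sqrt n" using bwd[OF y] n by (intro divide_right_mono) auto
      finally show "L2_set ?g V \<le> b / sqrt n" .
      show "0 \<le> a / sqrt n" using a L2_set_nonneg[of ?f V] by linarith
    qed (rule L2_set_nonneg)
    also have "\<dots> = a * b / n" using n by simp
    finally have "n * \<bar>matrix_pow V ?P (s + r) x y - 1 / n\<bar> \<le> a * b"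
      using n by (simp add: field_simps)
    moreover have "matrix_pow V ?P (s + r) x y / uniform_dist V y - 1
        = n * (matrix_pow V ?P (s + r) x y - 1 / n)"
      using n by (simp add: uniform_dist_def n_def field_simps)
    ultimately show ?thesis using n by (simp add: abs_mult)
  qed
  then show ?thesis
    unfolding linf_dist_def using fw.finite_V x by (subst Max_le_iff) auto
qed

section \<open>A differential inequality for the spread\<close>

text \<open>
  A set \<open>S\<close> of size \<open>k\<close> has spread \<open>k z\<close> with \<open>z = sqrt ((n - k) / k)\<close>, and the second difference of
  \<open>sqrt (k (n - k))\<close> is at most \<open>- k growth z / (4 n^2)\<close>. The function is convex, but tends to infinity at
  \<open>0\<close>, where the value that belongs to \<open>S = V\<close> is \<open>0\<close>. Its largest convex minorant with value \<open>0\<close> at \<open>0\<close> is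
  \<open>16 z\<close> up to \<open>z = 1\<close>, where this line is tangent, and \<open>growth\<close> from there on.
\<close>

definition growth :: "real \<Rightarrow> real" where
  "growth z = (z + 1/z)^4 * z"

lemma growth_eq: "z > 0 \<Longrightarrow> growth z = (1 + z^2)^4 / z^3"
proof -
  assume z: "z > 0"
  have "z + 1/z = (1 + z^2) / z" using z by (simp add: field_simps power2_eq_square)
  then show ?thesis using z by (simp add: growth_def field_simps eval_nat_numeral)
qed

lemma growth_expand: "z > 0 \<Longrightarrow> growth z = z^5 + 4 * z^3 + 6 * z + 4 / z + 1 / z^3"
  by (simp add: growth_eq field_simps eval_nat_numeral)

lemma growth_ge_linear:
  assumes "z > 0"
  shows "16 * z \<le> growth z"
proof -
  have "z + 1/z - 2 = (z - 1)^2 / z"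
    using assms by (simp add: field_simps power2_eq_square)
  then have "2 \<le> z + 1/z" using assms by (smt (verit) divide_nonneg_pos zero_le_power2)
  then have "2^4 \<le> (z + 1/z)^4" by (intro power_mono) auto
  then show ?thesis using assms by (simp add: growth_def)
qed

lemma growth_mono:
  assumes "1 \<le> y" "y \<le> z"
  shows "growth y \<le> growth z"
proof -
  have "z + 1/z - (y + 1/y) = (z - y) * (y * z - 1) / (y * z)"
    using assms by (simp add: field_simps)
  moreover have "y * z \<ge> 1" using mult_mono[of 1 y 1 z] assms by simp
  ultimately have "y + 1/y \<le> z + 1/z"
    using assms by (smt (verit) divide_nonneg_pos mult_nonneg_nonneg)
  moreover have "0 \<le> y + 1/y" using assms by simp
  ultimately show ?thesis
    unfolding growth_def using assms by (intro mult_mono power_mono) auto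
qed

text \<open>
  Beyond \<open>z = 1\<close> the tangent line supports \<open>growth\<close> on all of \<open>(0, \<infinity>)\<close> and is nonpositive at \<open>0\<close>; the
  second fact makes it a valid bound for \<open>S = V\<close> too.
\<close>

lemma growth_tangent:
  assumes z: "1 \<le> z"
  obtains s where "\<And>y. y > 0 \<Longrightarrow> growth z + s * (y - z) \<le> growth y" "growth z - s * z \<le> 0"
proof -
  define s where "s = 5 * z^4 + 12 * z^2 + 6 - 4 / z^2 - 3 / z^4"
  have "growth z + s * (y - z) \<le> growth y" if y: "y > 0" for y
  proof -
    have "growth y - (growth z + s * (y - z))
        = (y - z)^2 * (y^3 + 2*y^2*z + 3*y*z^2 + 4*z^3 + 4 * (y + 2*z) + 4 / (y * z^2)
          + (3*y^2 + 2*y*z + z^2) / (y^3 * z^4))"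
      using y z by (simp add: growth_expand s_def field_simps eval_nat_numeral)
    also have "\<dots> \<ge> 0"
      using y z by (intro mult_nonneg_nonneg add_nonneg_nonneg) auto
    finally show ?thesis by linarith
  qed
  moreover have "growth z - s * z \<le> 0"
  proof -
    have eq: "growth z - s * z = 8 * (1/z - z^3) + 4 * (1/z^3 - z^5)"
      using z by (simp add: growth_expand s_def field_simps eval_nat_numeral)
    have "1/z \<le> 1" "1/z^3 \<le> 1" "z^3 \<ge> 1" "z^5 \<ge> 1" using z by auto
    then have "1/z - z^3 \<le> 0" "1/z^3 - z^5 \<le> 0" by simp_all
    moreover have "8 * p + 4 * q \<le> 0" if "p \<le> 0" "q \<le> 0" for p q :: real
      using that by linarith
    ultimately have "8 * (1/z - z^3) + 4 * (1/z^3 - z^5) \<le> 0" by blast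
    with eq show ?thesis by simp
  qed
  ultimately show thesis by (rule that)
qed

text \<open>
  The time, up to scaling, that the differential equation \<open>z' = - growth z\<close> (with \<open>16 z\<close> in place of
  \<open>growth z\<close> for \<open>z \<le> 1\<close>) needs to descend from infinity to \<open>z\<close>: its derivative is \<open>- 4 / growth z\<close> and it
  vanishes at infinity.
\<close>

definition potential :: "real \<Rightarrow> real" where
  "potential z = (if z \<le> 1 then 1/6 - ln z / 4 else (1 + 3 * z^2) / (3 * (1 + z^2)^3))"

lemma potential_ge_1: "z \<ge> 1 \<Longrightarrow> potential z = (1 + 3 * z^2) / (3 * (1 + z^2)^3)"
  by (cases "z = 1") (simp_all add: potential_def)

text \<open>
  The speed of descent increases with \<open>z\<close>, so the way from \<open>z\<close> down to \<open>y\<close> takes at least as long as it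
  would at the initial speed. One discrete step of the recursion moves at that speed.
\<close>

lemma potential_diff:
  assumes "0 < y" "y \<le> z"
  shows "4 * (z - y) / (if z \<le> 1 then 16 * z else growth z) \<le> potential y - potential z"
proof -
  have low: "4 * (b - a) / (16 * b) \<le> potential a - potential b" if "0 < a" "a \<le> b" "b \<le> 1" for a b
  proof -
    have "ln (a / b) \<le> a / b - 1" using that by (intro ln_le_minus_one) auto
    then show ?thesis using that by (simp add: potential_def ln_div field_simps)
  qed
  have high: "4 * (b - a) / growth b \<le> potential a - potential b" if ab: "1 \<le> a" "a \<le> b" for a b
  proof -
    (* The derivative of f is 4 / growth b - 4 / growth u. *)
    define f where "f = (\<lambda>u. (1 + 3 * u^2) / (3 * (1 + u^2)^3) + 4 * u / growth b)"
    have "f b \<le> f a"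
    proof (rule DERIV_nonpos_imp_nonincreasing[OF ab(2)])
      fix u assume u: "a \<le> u" "u \<le> b"
      have pos: "1 + u^2 > 0" by (smt (verit) zero_le_power2)
      have "((\<lambda>u. (1 + 3 * u^2) / (3 * (1 + u^2)^3)) has_real_derivative
          - 4 * u^3 / (1 + u^2)^4) (at u)"
        using pos
        by (auto intro!: derivative_eq_intros simp: divide_simps) (simp add: algebra_simps eval_nat_numeral)
      then have "(f has_real_derivative - 4 * u^3 / (1 + u^2)^4 + 4 / growth b) (at u)"
        unfolding f_def
        using DERIV_add[OF _ DERIV_cdivide[OF DERIV_cmult_Id[of 4 u], of "growth b"]] by blast
      moreover have "- 4 * u^3 / (1 + u^2)^4 = - 4 / growth u"
        using u ab by (simp add: growth_eq)
      moreover have "0 < growth u" "growth u \<le> growth b"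
        using u ab growth_ge_linear[of u] growth_mono[of u b] by auto
      then have "- 4 / growth u + 4 / growth b \<le> 0" by (simp add: field_simps)
      ultimately show "\<exists>d. (f has_real_derivative d) (at u) \<and> d \<le> 0" by auto
    qed
    moreover have "potential a = f a - 4 * a / growth b" "potential b = f b - 4 * b / growth b"
      using ab by (auto simp: potential_ge_1 f_def)
    ultimately show ?thesis by (simp add: diff_divide_distrib)
  qed
  show ?thesis
  proof (cases "z \<le> 1")
    case True
    then show ?thesis using low[of y z] assms by simp
  next
    case False
    show ?thesis
    proof (cases "1 \<le> y")
      case True
      then show ?thesis using high[of y z] assms False by simp
    next
      case y: False
      have "growth z \<ge> 16" using growth_ge_linear[of z] False by linarith
      then have "4 * (1 - y) / growth z \<le> 4 * (1 - y) / 16"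
        using y by (intro divide_left_mono) auto
      also have "\<dots> \<le> potential y - potential 1" using low[of y 1] y assms by simp
      finally have "4 * (1 - y) / growth z + 4 * (z - 1) / growth z \<le> potential y - potential z"
        using high[of 1 z] False by simp
      then show ?thesis using False by (simp add: diff_divide_distrib)
    qed
  qed
qed

section \<open>Decay along a drifting evolving set\<close>

text \<open>
  From every proper set, the expected positive part of the change in size is at least \<open>\<delta>\<close> (the sum
  uses truncated subtraction). As the size is a martingale, the expected negative part is the same.
\<close>

locale drifting = biregular V W D for V :: "'a set" and W D +
  fixes \<delta> :: real
  assumes card_V: "card V \<ge> 2" and delta_pos: "\<delta> > 0" and delta_le_1: "\<delta> \<le> 1"
    and drift: "\<lbrakk>A \<subseteq> V; A \<noteq> {}; A \<noteq> V\<rbrakk> \<Longrightarrow>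
      \<delta> * real D \<le> (\<Sum>j=1..D. real (card (level A j) - card A))"
begin

lemma proper_card: "\<lbrakk>A \<subseteq> V; A \<noteq> {}; A \<noteq> V\<rbrakk> \<Longrightarrow> 0 < card A \<and> card A < card V"
  using finite_V finite_subset_V by (auto simp: card_gt_0_iff psubset_card_mono)

text \<open>
  Among integer-valued jumps of mean zero whose positive part has a given mean, jumps by \<open>1\<close> reduce the
  expectation of a concave function the least: the value after a longer jump lies below
  the lines through the value at \<open>k\<close> and those at its neighbours.
\<close>

lemma avg_concave_le:
  fixes g :: "nat \<Rightarrow> real"
  assumes A: "A \<subseteq> V" "A \<noteq> {}" "A \<noteq> V"
    and conc: "\<And>i. 0 < i \<Longrightarrow> i < card V \<Longrightarrow> g (i+1) + g (i-1) \<le> 2 * g i"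
  shows "avg (\<lambda>S. g (card S)) A
    \<le> g (card A) + \<delta> * (g (card A + 1) + g (card A - 1) - 2 * g (card A))"
proof -
  define k where "k = card A"
  have k: "0 < k" "k < card V" using proper_card[OF A] by (auto simp: k_def)
  let ?U = "\<Sum>j=1..D. real (card (level A j) - k)"
  let ?L = "\<Sum>j=1..D. real (k - card (level A j))"
  have "?U - ?L = (\<Sum>j=1..D. real (card (level A j)) - real k)"
    by (simp only: sum_subtractf[symmetric]) (rule sum.cong, auto)
  also have "\<dots> = 0" using sum_card_levels[OF A(1)] by (simp add: sum_subtractf k_def)
  finally have UL: "?L = ?U" by simp
  have "(\<Sum>j=1..D. g (card (level A j)))
      \<le> (\<Sum>j=1..D. g k + real (card (level A j) - k) * (g (k+1) - g k)
          + real (k - card (level A j)) * (g (k-1) - g k))"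
    by (intro sum_mono concave_seq_le_tangent[OF conc k] card_le_V level_subset)
  also have "\<dots> = real D * g k + ?U * (g (k+1) - g k) + ?L * (g (k-1) - g k)"
    by (simp add: sum.distrib sum_distrib_right)
  also have "\<dots> = real D * g k + ?U * (g (k+1) + g (k-1) - 2 * g k)"
    unfolding UL by (simp add: algebra_simps)
  also have "\<dots> \<le> real D * g k + (\<delta> * real D) * (g (k+1) + g (k-1) - 2 * g k)"
    using drift[OF A] conc[OF k] by (intro add_left_mono mult_right_mono_neg) (auto simp: k_def)
  also have "\<dots> = real D * (g k + \<delta> * (g (k+1) + g (k-1) - 2 * g k))"
    by (simp add: algebra_simps)
  finally show ?thesis
    using D_pos by (simp add: avg_def k_def divide_le_eq mult.commute)
qed

text \<open>
  \<open>sin (\<pi> k / n)\<close> is an eigenfunction of the second difference with Dirichlet conditions at \<open>0\<close> and \<open>n\<close>;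
  \<open>rate\<close> is the resulting decay factor.
\<close>

definition rate :: real where
  "rate = 1 - 2 * \<delta> * (1 - cos (pi / card V))"

lemma avg_sin_le:
  assumes "S \<subseteq> V"
  shows "avg (\<lambda>S. sin (pi * card S / card V)) S \<le> rate * sin (pi * card S / card V)"
proof (cases "S = {} \<or> S = V")
  case True
  then show ?thesis using card_V by (auto simp: avg_trivial)
next
  case False
  define \<theta> where "\<theta> = pi / card V"
  define g where "g = (\<lambda>k::nat. sin (\<theta> * k))"
  have second_diff: "g (i+1) + g (i-1) - 2 * g i = - 2 * (1 - cos \<theta>) * g i" if "0 < i" for i
    using that by (simp add: g_def of_nat_diff algebra_simps sin_add sin_diff)
  have "avg (\<lambda>S. g (card S)) S
      \<le> g (card S) + \<delta> * (g (card S + 1) + g (card S - 1) - 2 * g (card S))"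
  proof (rule avg_concave_le)
    fix i assume i: "0 < i" "i < card V"
    have "0 \<le> g i"
      unfolding g_def \<theta>_def using i by (intro sin_ge_zero) (auto simp: field_simps)
    then have "0 \<le> 2 * (1 - cos \<theta>) * g i" by (intro mult_nonneg_nonneg) auto
    then show "g (i+1) + g (i-1) \<le> 2 * g i" using second_diff[OF i(1)] by linarith
  qed (use assms False in auto)
  also have "\<dots> = rate * g (card S)"
    using second_diff[of "card S"] proper_card[of S] assms False
    by (simp add: rate_def \<theta>_def algebra_simps)
  finally show ?thesis by (simp add: g_def \<theta>_def field_simps)
qed

text \<open>
  The expectation of a nonnegative function is nonnegative, so a negative factor would contradict
  \<open>avg_sin_le\<close> at a singleton.
\<close>

lemma rate_nonneg: "0 \<le> rate"
proof -
  obtain x where x: "x \<in> V" using card_V by fastforce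
  have "0 \<le> avg (\<lambda>S. sin (pi * card S / card V)) {x}"
  proof -
    have "avg (\<lambda>S. 0) {x} \<le> avg (\<lambda>S. sin (pi * card S / card V)) {x}"
      using card_V card_le_V by (intro avg_mono sin_ge_zero) (auto simp: field_simps)
    then show ?thesis by (simp add: avg_def)
  qed
  also have "\<dots> \<le> rate * sin (pi / card V)" using avg_sin_le[of "{x}"] x by simp
  finally show ?thesis
    using sin_multiple_bounds(3)[of 1 "card V"] card_V by (simp add: zero_le_mult_iff)
qed

lemma rate_less_1: "rate < 1"
proof -
  have "cos (pi / card V) < cos 0"
    using card_V by (intro cos_monotone_0_pi) (auto simp: field_simps)
  then show ?thesis using delta_pos by (simp add: rate_def)
qed

lemma evolve_sin_le:
  assumes "A \<subseteq> V"
  shows "(avg ^^ t) (\<lambda>S. sin (pi * card S / card V)) A \<le> rate ^ t * sin (pi * card A / card V)"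
proof (induction t)
  case (Suc t)
  have "(avg ^^ Suc t) (\<lambda>S. sin (pi * card S / card V)) A
      = (avg ^^ t) (avg (\<lambda>S. sin (pi * card S / card V))) A"
    by (simp add: funpow_swap1)
  also have "\<dots> \<le> (avg ^^ t) (\<lambda>S. rate * sin (pi * card S / card V)) A"
    by (intro evolve_mono avg_sin_le assms)
  also have "\<dots> \<le> rate * (rate ^ t * sin (pi * card A / card V))"
    unfolding evolve_scale by (intro mult_left_mono Suc.IH rate_nonneg)
  finally show ?case by simp
qed simp

text \<open>
  The multiple of the sine that dominates \<open>f\<close> has the value \<open>c\<close> at singletons, where the process starts.
\<close>

lemma evolve_dominated_le:
  assumes x: "x \<in> V" and c: "c \<ge> 0"
    and dom: "\<And>k. k \<le> card V \<Longrightarrow> f k * sin (pi / card V) \<le> c * sin (pi * k / card V)"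
  shows "(avg ^^ t) (\<lambda>S. f (card S)) {x} \<le> c * rate ^ t"
proof -
  let ?s = "sin (pi / card V)"
  have s: "?s > 0" using sin_multiple_bounds(3)[of 1 "card V"] card_V by simp
  have "(avg ^^ t) (\<lambda>S. f (card S)) {x} \<le> (avg ^^ t) (\<lambda>S. c / ?s * sin (pi * card S / card V)) {x}"
    using dom s x by (intro evolve_mono) (auto simp: field_simps card_le_V)
  also have "\<dots> = c / ?s * (avg ^^ t) (\<lambda>S. sin (pi * card S / card V)) {x}"
    by (rule evolve_scale)
  also have "\<dots> \<le> c / ?s * (rate ^ t * ?s)"
    using evolve_sin_le[of "{x}" t] x c s by (intro mult_left_mono) auto
  finally show ?thesis using s by simp
qed

lemma tv_dist_le:
  assumes "x \<in> V"
  shows "tv_dist V (uniform_dist V) kernel t x \<le> (1 - 1 / real (card V)) * rate ^ t"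
proof -
  have "(avg ^^ t) (\<lambda>S. real (card S) * (real (card V) - card S)) {x} \<le> (real (card V) - 1) * rate ^ t"
  proof (rule evolve_dominated_le[OF assms])
    fix k assume "k \<le> card V"
    then show "real k * (real (card V) - real k) * sin (pi / card V)
        \<le> (real (card V) - 1) * sin (pi * k / card V)"
      using sin_multiple_bounds(1)[of k "card V"] by (cases "k = 0"; cases "k = card V") auto
  qed (use card_V in simp)
  then have "tv_dist V (uniform_dist V) kernel t x \<le> (real (card V) - 1) * rate ^ t / card V"
    using tv_dist_le_evolve[OF assms, of t] divide_right_mono[of _ _ "real (card V)"] by fastforce
  then show ?thesis using card_V by (simp add: field_simps)
qed

lemma evolve_spread_le:
  assumes "x \<in> V"
  shows "(avg ^^ t) spread {x} \<le> sqrt (real (card V) - 1) * rate ^ t"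
proof -
  let ?n = "card V"
  have "(avg ^^ t) (\<lambda>S. sqrt (real (card S) * (real ?n - card S))) {x} \<le> sqrt (real ?n - 1) * rate ^ t"
  proof (rule evolve_dominated_le[OF assms])
    fix k assume le: "k \<le> ?n"
    show "sqrt (real k * (real ?n - real k)) * sin (pi / ?n) \<le> sqrt (real ?n - 1) * sin (pi * k / ?n)"
    proof (cases "k = 0 \<or> k = ?n")
      case False
      then have k: "0 < k" "k < ?n" using le by auto
      note b = sin_multiple_bounds[OF k]
      have "(real k * (real ?n - real k) * sin (pi / ?n)) * sin (pi / ?n)
          \<le> ((real ?n - 1) * sin (pi * k / ?n)) * sin (pi * k / ?n)"
        by (rule mult_mono[OF b(1,2)]) (use b k in auto)
      then have "sqrt ((real k * (real ?n - real k)) * (sin (pi / ?n))\<^sup>2)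
          \<le> sqrt ((real ?n - 1) * (sin (pi * k / ?n))\<^sup>2)"
        by (simp add: power2_eq_square mult.assoc)
      then show ?thesis using b by (simp add: real_sqrt_mult)
    qed auto
  qed (use card_V in simp)
  then show ?thesis unfolding spread_def .
qed

text \<open>
  Bounding the drop of the spread by any affine minorant of \<open>growth\<close> keeps the estimate linear in \<open>spread\<close>
  and \<open>card\<close>, so that it can be averaged over the process; this is Jensen's inequality for the process
  biased by size.
\<close>

lemma avg_spread_le:
  assumes S: "S \<subseteq> V" and minor: "\<And>z. z > 0 \<Longrightarrow> \<alpha> + \<beta> * z \<le> growth z" and "\<alpha> \<le> 0"
  shows "avg spread S
    \<le> spread S - \<delta> / (4 * real (card V)^2) * (\<alpha> * card S + \<beta> * spread S)"
proof (cases "S = {} \<or> S = V")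
  case True
  have "spread S = 0" using True by (auto simp: spread_def)
  moreover have "\<delta> / (4 * real (card V)^2) * (\<alpha> * card S) \<le> 0"
    using delta_pos \<open>\<alpha> \<le> 0\<close> by (intro mult_nonneg_nonpos mult_nonpos_nonneg) auto
  moreover have "avg spread S = 0" using True \<open>spread S = 0\<close> by (simp only: avg_trivial)
  ultimately show ?thesis by simp
next
  case False
  define n where "n = real (card V)"
  define k where "k = real (card S)"
  have k: "0 < k" "k < n" using proper_card[OF S] False by (auto simp: k_def n_def)
  have sp: "spread S = sqrt (k * (n - k))" by (simp add: spread_def k_def n_def)
  have pos: "spread S > 0" using k by (simp add: sp)
  define g where "g = (\<lambda>i::nat. sqrt (real i * (real (card V) - real i)))"
  have second_diff: "g (i+1) + g (i-1) \<le> 2 * g i - n^2 / (4 * (g i)^3)"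
    if "0 < i" "i < card V" for i
    using sqrt_second_difference[OF that] by (simp add: g_def n_def)
  have "avg (\<lambda>S. g (card S)) S
      \<le> g (card S) + \<delta> * (g (card S + 1) + g (card S - 1) - 2 * g (card S))"
  proof (rule avg_concave_le[OF S])
    fix i assume i: "0 < i" "i < card V"
    have "0 \<le> n^2 / (4 * (g i)^3)" using i by (auto simp: g_def)
    then show "g (i+1) + g (i-1) \<le> 2 * g i" using second_diff[OF i] by linarith
  qed (use False in auto)
  also have "\<dots> \<le> g (card S) + \<delta> * (- (n^2 / (4 * (g (card S))^3)))"
    using second_diff[of "card S"] proper_card[OF S] False delta_pos
    by (intro add_left_mono mult_left_mono) auto
  finally have "avg spread S \<le> spread S - \<delta> * (n^2 / (4 * (spread S)^3))"
    by (simp add: spread_def[abs_def] g_def)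
  also have "n^2 / (4 * (spread S)^3) = k * growth (spread S / k) / (4 * n^2)"
  proof -
    have "1 + (spread S / k)^2 = n / k"
      using k by (simp add: sp power_divide real_sqrt_pow2 field_simps power2_eq_square)
    then have "growth (spread S / k) = (n / k)^4 / (spread S / k)^3"
      using pos k by (simp add: growth_eq)
    then show ?thesis using pos k by (simp add: power_divide field_simps eval_nat_numeral)
  qed
  also have "spread S - \<delta> * (k * growth (spread S / k) / (4 * n^2))
      \<le> spread S - \<delta> * (k * (\<alpha> + \<beta> * (spread S / k)) / (4 * n^2))"
    using pos k delta_pos minor[of "spread S / k"]
    by (intro diff_left_mono mult_left_mono divide_right_mono) auto
  also have "\<dots> = spread S - \<delta> / (4 * n^2) * (\<alpha> * k + \<beta> * spread S)"
    using k by (simp add: field_simps)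
  finally show ?thesis by (simp add: k_def n_def)
qed

definition mean_spread :: "'a \<Rightarrow> nat \<Rightarrow> real" where
  "mean_spread x t = (avg ^^ t) spread {x}"

lemma mean_spread_nonneg: "x \<in> V \<Longrightarrow> 0 \<le> mean_spread x t"
proof -
  assume x: "x \<in> V"
  have "(avg ^^ t) (\<lambda>S. 0 * real (card S)) {x} \<le> (avg ^^ t) spread {x}"
    using x by (intro evolve_mono) (auto simp: spread_def card_le_V)
  then show ?thesis unfolding evolve_scale by (simp add: mean_spread_def)
qed

lemma mean_spread_Suc_affine:
  assumes x: "x \<in> V" and minor: "\<And>z. z > 0 \<Longrightarrow> \<alpha> + \<beta> * z \<le> growth z" and "\<alpha> \<le> 0"
  shows "mean_spread x (Suc t)
    \<le> mean_spread x t - \<delta> / (4 * real (card V)^2) * (\<alpha> + \<beta> * mean_spread x t)"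
proof -
  define c where "c = \<delta> / (4 * real (card V)^2)"
  have "mean_spread x (Suc t) = (avg ^^ t) (avg spread) {x}"
    by (simp add: mean_spread_def funpow_swap1)
  also have "\<dots> \<le> (avg ^^ t) (\<lambda>S. (1 - c * \<beta>) * spread S + (- c * \<alpha>) * card S) {x}"
  proof (rule evolve_mono)
    fix S assume "S \<subseteq> V"
    then have "avg spread S \<le> spread S - c * (\<alpha> * card S + \<beta> * spread S)"
      using avg_spread_le[OF _ minor \<open>\<alpha> \<le> 0\<close>] by (simp add: c_def)
    then show "avg spread S \<le> (1 - c * \<beta>) * spread S + (- c * \<alpha>) * card S"
      by (simp add: algebra_simps)
  qed (use x in simp)
  also have "\<dots> = (1 - c * \<beta>) * mean_spread x t + (- c * \<alpha>) * 1"
    unfolding evolve_linear using evolve_card[of "{x}"] x by (simp add: mean_spread_def)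
  finally show ?thesis unfolding c_def[symmetric] by (simp add: algebra_simps)
qed

text \<open>
  The affine minorant is the line that supports the convex minorant of \<open>growth\<close> at the current mean.
\<close>

lemma mean_spread_Suc:
  assumes "x \<in> V"
  shows "mean_spread x (Suc t) \<le> mean_spread x t - \<delta> / (4 * real (card V)^2) *
    (if mean_spread x t \<le> 1 then 16 * mean_spread x t else growth (mean_spread x t))"
proof (cases "mean_spread x t \<le> 1")
  case True
  then show ?thesis
    using mean_spread_Suc_affine[OF assms, of 0 16 t] growth_ge_linear by simp
next
  case False
  define z where "z = mean_spread x t"
  obtain s where s: "\<And>y. y > 0 \<Longrightarrow> growth z + s * (y - z) \<le> growth y" "growth z - s * z \<le> 0"
    using growth_tangent[of z] False z_def by auto
  have "mean_spread x (Suc t)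
      \<le> mean_spread x t - \<delta> / (4 * real (card V)^2) * ((growth z - s * z) + s * mean_spread x t)"
    using s by (intro mean_spread_Suc_affine[OF assms]) (auto simp: algebra_simps)
  then show ?thesis using False by (simp add: z_def)
qed

lemma mean_spread_0: "x \<in> V \<Longrightarrow> mean_spread x 0 = sqrt (real (card V) - 1)"
  by (simp add: mean_spread_def spread_def)

text \<open>
  Each step gains one unit of scaled potential. The value \<open>2/3\<close> present at time \<open>0\<close> comes from
  the finite initial spread \<open>sqrt (n - 1)\<close>; it exceeds the loss of \<open>1/2\<close> in halving an odd number of steps.
\<close>

lemma potential_mean_spread:
  assumes x: "x \<in> V"
  shows "mean_spread x t = 0
    \<or> real t + 2/3 \<le> real (card V)^2 / \<delta> * potential (mean_spread x t)"
proof (induction t)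
  case 0
  define n where "n = real (card V)"
  have n: "n \<ge> 2" using card_V by (simp add: n_def)
  have "n^2 * potential (sqrt (n - 1)) = 1 - 2 / (3 * n)"
    using n by (simp add: potential_ge_1 field_simps eval_nat_numeral)
  also have "\<dots> \<ge> 2/3" using n by (simp add: field_simps)
  finally have ge: "2/3 \<le> n^2 * potential (sqrt (n - 1))" .
  also have "\<dots> \<le> n^2 * potential (sqrt (n - 1)) / \<delta>"
    using ge delta_pos delta_le_1 by (intro le_divide_eq_1_pos[THEN iffD2] mult_imp_le_div_pos)
      (auto simp: mult_left_le)
  finally show ?case using x by (simp add: mean_spread_0 n_def)
next
  case (Suc t)
  define n where "n = real (card V)"
  have n: "n \<ge> 2" using card_V by (simp add: n_def)
  let ?z = "mean_spread x t" and ?z' = "mean_spread x (Suc t)"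
  define G where "G = (if ?z \<le> 1 then 16 * ?z else growth ?z)"
  have step: "?z' \<le> ?z - \<delta> / (4 * n^2) * G"
    using mean_spread_Suc[OF x, of t] by (simp add: G_def n_def)
  have nonneg: "0 \<le> ?z" "0 \<le> ?z'" using mean_spread_nonneg[OF x] by auto
  show ?case
  proof (cases "?z' = 0")
    case False
    then have z': "?z' > 0" using nonneg by linarith
    have z: "?z > 0"
    proof (rule ccontr)
      assume "\<not> ?z > 0"
      then have "?z = 0" using nonneg by linarith
      then show False using step z' by (simp add: G_def)
    qed
    then have G: "G > 0" using growth_ge_linear[OF z] by (auto simp: G_def)
    have dec: "\<delta> / (4 * n^2) * G \<le> ?z - ?z'" using step by linarith
    have "?z' \<le> ?z"
      using step G delta_pos n by (smt (verit) divide_pos_pos mult_pos_pos zero_less_power)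
    then have "4 * (?z - ?z') / G \<le> potential ?z' - potential ?z"
      using potential_diff[OF z'] by (simp add: G_def)
    moreover have "4 * (\<delta> / (4 * n^2) * G) / G \<le> 4 * (?z - ?z') / G"
      using dec G by (intro divide_right_mono mult_left_mono) auto
    moreover have "4 * (\<delta> / (4 * n^2) * G) / G = \<delta> / n^2" using G by simp
    ultimately have "\<delta> / n^2 \<le> potential ?z' - potential ?z" by linarith
    then have "n^2 / \<delta> * (\<delta> / n^2) \<le> n^2 / \<delta> * (potential ?z' - potential ?z)"
      using delta_pos by (intro mult_left_mono) auto
    then have "1 \<le> n^2 / \<delta> * potential ?z' - n^2 / \<delta> * potential ?z"
      using delta_pos n by (simp add: right_diff_distrib)
    then show ?thesis using Suc.IH z by (simp add: n_def)
  qed simp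
qed

lemma mean_spread_le:
  assumes x: "x \<in> V" and y: "y > 0"
    and t: "real (card V)^2 / \<delta> * potential y < real t + 2/3"
  shows "mean_spread x t \<le> y"
proof (rule ccontr)
  let ?z = "mean_spread x t"
  assume neg: "\<not> ?z \<le> y"
  then have "?z \<noteq> 0" using y by linarith
  then have "real t + 2/3 \<le> real (card V)^2 / \<delta> * potential ?z"
    using potential_mean_spread[OF x] by blast
  also have "potential ?z \<le> potential y"
  proof -
    have "0 \<le> 4 * (?z - y) / (if ?z \<le> 1 then 16 * ?z else growth ?z)"
      using neg y growth_ge_linear[of ?z] by (intro divide_nonneg_nonneg) auto
    then show ?thesis using potential_diff[OF y, of ?z] neg by linarith
  qed
  then have "real (card V)^2 / \<delta> * potential ?z \<le> real (card V)^2 / \<delta> * potential y"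
    using delta_pos by (intro mult_left_mono) auto
  finally show False using t by linarith
qed

end

section \<open>Eigenvalues, quadratic forms and mixing times\<close>

lemma geometric_le_of_inv_neg_log:
  assumes q: "0 \<le> q" "q < 1" and c: "0 < c" and e: "0 < \<epsilon>" and t: "0 < t"
    and le: "inv_neg_log q * ln (c / \<epsilon>) \<le> real t"
  shows "c * q ^ t \<le> \<epsilon>"
proof (cases "q = 0")
  (* Here the time bound is 0 by convention, and a positive t makes the power vanish. *)
  case True
  then show ?thesis using t e by (simp add: power_0_left)
next
  case False
  then have q0: "q > 0" using q by simp
  then have L: "- ln q > 0" using q by simp
  then have "ln (c / \<epsilon>) \<le> real t * (- ln q)"
    using le False by (simp add: inv_neg_log_def field_simps)
  then have "ln (c / \<epsilon>) + ln (q ^ t) \<le> 0" using q0 by (simp add: ln_realpow)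
  then have "ln (c / \<epsilon> * q ^ t) \<le> 0" using q0 c e by (subst ln_mult_pos) auto
  then have "c / \<epsilon> * q ^ t \<le> 1" using q0 c e by (subst (asm) ln_le_zero_iff) auto
  then show ?thesis using e by (simp add: field_simps)
qed

lemma base_le_of_powers_le:
  fixes a b C :: real
  assumes "0 \<le> a" "0 \<le> b" and le: "\<And>k::nat. \<exists>t\<ge>k. a ^ t \<le> C * b ^ t"
  shows "a \<le> b"
proof (rule ccontr)
  assume "\<not> a \<le> b"
  then have ab: "b < a" "0 < a" using assms by auto
  have "0 < 1 / (\<bar>C\<bar> + 1)" by (intro divide_pos_pos) auto
  moreover have "b / a < 1" using ab by simp
  ultimately obtain k where k: "(b / a) ^ k < 1 / (\<bar>C\<bar> + 1)"
    by (rule real_arch_pow_inv[THEN exE])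
  obtain t where t: "t \<ge> k" "a ^ t \<le> C * b ^ t" using le by blast
  have "(b / a) ^ t \<le> (b / a) ^ k"
    using t(1) ab assms by (intro power_decreasing) auto
  then have *: "(b / a) ^ t < 1 / (\<bar>C\<bar> + 1)" using k by linarith
  have "1 \<le> C * (b / a) ^ t" using t(2) ab by (simp add: power_divide)
  also have "\<dots> \<le> (\<bar>C\<bar> + 1) * (b / a) ^ t" using ab assms by (intro mult_right_mono) auto
  also have "\<dots> < 1" using * by (simp add: field_simps)
  finally show False by simp
qed

lemma dirichlet_form_doubly_stochastic:
  fixes P :: "'a \<Rightarrow> 'a \<Rightarrow> real"
  assumes "\<And>x. x \<in> V \<Longrightarrow> (\<Sum>y\<in>V. P x y) = 1" "\<And>y. y \<in> V \<Longrightarrow> (\<Sum>x\<in>V. P x y) = 1"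
  shows "(\<Sum>x\<in>V. \<Sum>y\<in>V. (f x - f y)\<^sup>2 * P x y)
    = 2 * (\<Sum>x\<in>V. (f x)\<^sup>2) - 2 * (\<Sum>x\<in>V. \<Sum>y\<in>V. f x * P x y * f y)"
proof -
  have "(\<Sum>x\<in>V. \<Sum>y\<in>V. (f x - f y)\<^sup>2 * P x y)
      = (\<Sum>x\<in>V. \<Sum>y\<in>V. (f x)\<^sup>2 * P x y) + (\<Sum>x\<in>V. \<Sum>y\<in>V. (f y)\<^sup>2 * P x y)
        - 2 * (\<Sum>x\<in>V. \<Sum>y\<in>V. f x * P x y * f y)"
    by (simp add: power2_diff algebra_simps sum.distrib sum_subtractf sum_distrib_left)
  moreover have "(\<Sum>x\<in>V. \<Sum>y\<in>V. (f x)\<^sup>2 * P x y) = (\<Sum>x\<in>V. (f x)\<^sup>2)"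
    by (simp add: assms(1) flip: sum_distrib_left)
  moreover have "(\<Sum>x\<in>V. \<Sum>y\<in>V. (f y)\<^sup>2 * P x y) = (\<Sum>y\<in>V. (f y)\<^sup>2)"
    by (subst sum.swap) (simp add: assms(2) flip: sum_distrib_left)
  ultimately show ?thesis by simp
qed

context drifting
begin

lemma matrix_pow_centered_bound:
  fixes f :: "'a \<Rightarrow> 'b::real_normed_field"
  assumes x: "x \<in> V" and bound: "\<And>y. y \<in> V \<Longrightarrow> norm (f y) \<le> m" and sum0: "(\<Sum>y\<in>V. f y) = 0"
  shows "norm (\<Sum>y\<in>V. of_real (matrix_pow V kernel t x y) * f y) \<le> 2 * rate ^ t * m"
proof -
  let ?n = "real (card V)"
  have m: "0 \<le> m" using bound[OF x] norm_ge_zero order_trans by blast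
  have "(\<Sum>y\<in>V. of_real (matrix_pow V kernel t x y) * f y)
      = (\<Sum>y\<in>V. of_real (matrix_pow V kernel t x y - 1 / ?n) * f y)"
    by (simp add: left_diff_distrib sum_subtractf sum0 flip: sum_distrib_left sum_divide_distrib)
  also have "norm \<dots> \<le> (\<Sum>y\<in>V. \<bar>matrix_pow V kernel t x y - 1 / ?n\<bar> * m)"
    by (intro sum_norm_le) (simp add: norm_mult bound mult_left_mono del: of_real_diff)
  also have "\<dots> = 2 * tv_dist V (uniform_dist V) kernel t x * m"
    by (simp add: tv_dist_def uniform_dist_def sum_distrib_right)
  also have "\<dots> \<le> 2 * rate ^ t * m"
  proof -
    have "tv_dist V (uniform_dist V) kernel t x \<le> 1 * rate ^ t"
      by (rule order_trans[OF tv_dist_le[OF x]])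
        (intro mult_right_mono, use rate_nonneg card_V in auto)
    then show ?thesis using m by (intro mult_right_mono) auto
  qed
  finally show ?thesis .
qed

text \<open>
  An eigenvector of an eigenvalue other than \<open>1\<close> sums to zero, as the columns sum to \<open>1\<close>. The powers of the matrix therefore contract it
  like \<open>rate ^ t\<close>, up to a constant that disappears as \<open>t\<close> grows.
\<close>

lemma eigenvalue_le_rate:
  assumes ev: "is_eigenvalue V kernel z" and z: "z \<noteq> 1"
  shows "cmod z \<le> rate"
proof -
  obtain f where f: "\<exists>x\<in>V. f x \<noteq> 0"
    and eig: "\<And>x. x \<in> V \<Longrightarrow> (\<Sum>y\<in>V. complex_of_real (kernel x y) * f y) = z * f x"
    using ev by (auto simp: is_eigenvalue_def)
  have "(\<Sum>y\<in>V. f y) = (\<Sum>y\<in>V. complex_of_real (\<Sum>x\<in>V. kernel x y) * f y)"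
    by (simp add: kernel_column_sum)
  also have "\<dots> = (\<Sum>x\<in>V. \<Sum>y\<in>V. complex_of_real (kernel x y) * f y)"
    by (simp add: sum_distrib_right) (rule sum.swap)
  also have "\<dots> = z * (\<Sum>x\<in>V. f x)" by (simp add: eig sum_distrib_left)
  finally have sum0: "(\<Sum>x\<in>V. f x) = 0" using z by simp
  have pow: "(\<Sum>y\<in>V. complex_of_real (matrix_pow V kernel t x y) * f y) = z ^ t * f x"
    if "x \<in> V" for t x
    using that
  proof (induction t arbitrary: x)
    case 0
    have "(\<Sum>y\<in>V. complex_of_real (matrix_pow V kernel 0 x y) * f y)
        = (\<Sum>y\<in>V. if x = y then f y else 0)"
      by (rule sum.cong) auto
    then show ?case using 0 finite_V by simp
  next
    case (Suc t)
    have "(\<Sum>y\<in>V. complex_of_real (matrix_pow V kernel (Suc t) x y) * f y)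
        = (\<Sum>w\<in>V. complex_of_real (kernel x w)
            * (\<Sum>y\<in>V. complex_of_real (matrix_pow V kernel t w y) * f y))"
      by (simp add: sum_distrib_right sum_distrib_left mult.assoc) (rule sum.swap)
    also have "\<dots> = (\<Sum>w\<in>V. complex_of_real (kernel x w) * (z ^ t * f w))"
      by (simp add: Suc.IH)
    also have "\<dots> = z ^ t * (\<Sum>w\<in>V. complex_of_real (kernel x w) * f w)"
      by (simp add: sum_distrib_left mult_ac)
    finally show ?case using eig[OF Suc.prems] by simp
  qed
  define m where "m = Max ((\<lambda>x. cmod (f x)) ` V)"
  have fin: "finite ((\<lambda>x. cmod (f x)) ` V)" "(\<lambda>x. cmod (f x)) ` V \<noteq> {}"
    using finite_V f by auto
  obtain x where x: "x \<in> V" "cmod (f x) = m" using Max_in[OF fin] by (auto simp: m_def)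
  have le_m: "cmod (f y) \<le> m" if "y \<in> V" for y using fin that by (simp add: m_def)
  have "m > 0" using f le_m by (metis norm_le_zero_iff not_le order_trans)
  have "cmod z ^ t \<le> 2 * rate ^ t" for t
  proof -
    have "cmod z ^ t * m = norm (\<Sum>y\<in>V. complex_of_real (matrix_pow V kernel t x y) * f y)"
      using x by (simp add: pow norm_mult norm_power)
    also have "\<dots> \<le> 2 * rate ^ t * m"
      by (rule matrix_pow_centered_bound[OF x(1) le_m sum0])
    finally show ?thesis using \<open>m > 0\<close> by simp
  qed
  then have "\<exists>t\<ge>k. cmod z ^ t \<le> 2 * rate ^ t" for k by (intro exI[of _ k]) simp
  then show ?thesis by (rule base_le_of_powers_le[OF norm_ge_zero rate_nonneg])
qed

text \<open>
  For \<open>q t = <f, P^t f>\<close> with symmetric \<open>P\<close>, the Cauchy-Schwarz inequality gives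
  \<open>(q t)^2 \<le> <f, f> q (2 t)\<close>. Repeated doubling bounds \<open>q 1\<close> through the decay of \<open>q (2 ^ k)\<close>, without a
  spectral decomposition.
\<close>

lemma symmetric_quadratic_form_le:
  fixes f :: "'a \<Rightarrow> real"
  assumes sym: "\<And>x y. W x y = W y x" and sum0: "(\<Sum>x\<in>V. f x) = 0"
  shows "(\<Sum>x\<in>V. \<Sum>y\<in>V. f x * kernel x y * f y) \<le> rate * (\<Sum>x\<in>V. (f x)\<^sup>2)"
proof -
  define N where "N = (\<Sum>x\<in>V. (f x)\<^sup>2)"
  define g where "g = (\<lambda>t x. \<Sum>y\<in>V. matrix_pow V kernel t x y * f y)"
  define q where "q = (\<lambda>t. \<Sum>x\<in>V. f x * g t x)"
  have N: "0 \<le> N" by (simp add: N_def sum_nonneg)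
  have pow_sym: "matrix_pow V kernel t x y = matrix_pow V kernel t y x" if "x \<in> V" "y \<in> V" for t x y
    using matrix_pow_transpose[OF finite_V that, of kernel t] by (simp add: kernel_def[abs_def] sym)
  have inner: "(\<Sum>x\<in>V. g t x * g t x) = q (t + t)" for t
  proof -
    have "g (t + t) x = (\<Sum>z\<in>V. matrix_pow V kernel t x z * g t z)" if x: "x \<in> V" for x
      unfolding g_def matrix_pow_add[OF finite_V x]
      by (simp add: sum_distrib_left sum_distrib_right mult.assoc) (rule sum.swap)
    then have "q (t + t) = (\<Sum>x\<in>V. \<Sum>z\<in>V. f x * matrix_pow V kernel t x z * g t z)"
      by (simp add: q_def sum_distrib_left mult.assoc)
    also have "\<dots> = (\<Sum>z\<in>V. \<Sum>x\<in>V. f x * matrix_pow V kernel t x z * g t z)"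
      by (rule sum.swap)
    also have "\<dots> = (\<Sum>z\<in>V. (\<Sum>x\<in>V. matrix_pow V kernel t z x * f x) * g t z)"
      unfolding sum_distrib_right by (intro sum.cong refl) (simp add: pow_sym mult_ac)
    finally show ?thesis by (simp add: g_def)
  qed
  have CS: "(q t)\<^sup>2 \<le> N * q (t + t)" for t
  proof -
    have "(q t)\<^sup>2 \<le> (L2_set f V * L2_set (g t) V)\<^sup>2"
      using L2_set_mult_ineq[of f "g t" V] sum_abs[of "\<lambda>x. f x * g t x" V]
      by (intro abs_le_square_iff[THEN iffD1]) (simp add: q_def abs_mult L2_set_nonneg)
    also have "\<dots> = N * (\<Sum>x\<in>V. (g t x)\<^sup>2)"
      by (simp add: L2_set_def N_def power_mult_distrib sum_nonneg)
    also have "\<dots> = N * q (t + t)" using inner[of t] by (simp add: power2_eq_square)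
    finally show ?thesis .
  qed
  have q1: "q 1 = (\<Sum>x\<in>V. \<Sum>y\<in>V. f x * kernel x y * f y)"
  proof -
    have "matrix_pow V kernel 1 x y = kernel x y" if "x \<in> V" "y \<in> V" for x y
    proof -
      have "matrix_pow V kernel 1 x y = (\<Sum>z\<in>V. (if x = z then 1 else 0) * kernel z y)"
        using matrix_pow_Suc_right[OF finite_V that, of kernel 0] by (simp only: One_nat_def matrix_pow.simps(1))
      then show ?thesis using sum_delta_row[OF finite_V that(1), of "\<lambda>z. kernel z y"] by (simp only:)
    qed
    then have "q 1 = (\<Sum>x\<in>V. f x * (\<Sum>y\<in>V. kernel x y * f y))"
      unfolding q_def g_def by (intro sum.cong refl arg_cong2[where f = "(*)"]) (simp only:)
    then show ?thesis by (simp only: sum_distrib_left mult.assoc)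
  qed
  show ?thesis
  proof (cases "N = 0")
    case True
    then have "\<forall>x\<in>V. f x = 0" using finite_V by (simp add: N_def sum_nonneg_eq_0_iff)
    then show ?thesis by simp
  next
    case False
    then have N: "N > 0" using N by simp
    define r where "r = (\<lambda>t. q t / N)"
    have r_sq: "(r t)\<^sup>2 \<le> r (t + t)" for t
      using CS[of t] N by (simp add: r_def power_divide power2_eq_square field_simps)
    have r_pow: "\<bar>r 1\<bar> ^ (2 ^ k) \<le> \<bar>r (2 ^ k)\<bar>" for k
    proof (induction k)
      case (Suc k)
      have "\<bar>r 1\<bar> ^ (2 ^ Suc k) = (\<bar>r 1\<bar> ^ (2 ^ k))\<^sup>2"
        by (simp only: power_Suc2 power_mult)
      also have "\<dots> \<le> \<bar>r (2 ^ k)\<bar>\<^sup>2" by (intro power_mono Suc.IH) simp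
      also have "\<dots> \<le> r (2 ^ Suc k)" using r_sq[of "2 ^ k"] by (simp add: mult_2)
      finally show ?case by linarith
    qed simp
    define m where "m = Max ((\<lambda>x. \<bar>f x\<bar>) ` V)"
    have m: "\<bar>f x\<bar> \<le> m" if "x \<in> V" for x using finite_V that by (simp add: m_def)
    have "\<bar>r t\<bar> \<le> (\<Sum>x\<in>V. \<bar>f x\<bar> * (2 * m)) / N * rate ^ t" for t
    proof -
      have "\<bar>q t\<bar> \<le> (\<Sum>x\<in>V. \<bar>f x\<bar> * (2 * rate ^ t * m))"
        unfolding q_def
      proof (rule order_trans[OF sum_abs], rule sum_mono)
        fix x assume x: "x \<in> V"
        show "\<bar>f x * g t x\<bar> \<le> \<bar>f x\<bar> * (2 * rate ^ t * m)"
          using matrix_pow_centered_bound[OF x, of f m t] m sum0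
          by (auto simp: abs_mult g_def intro!: mult_left_mono)
      qed
      also have "\<dots> = (\<Sum>x\<in>V. \<bar>f x\<bar> * (2 * m)) * rate ^ t"
        unfolding sum_distrib_right by (intro sum.cong refl) (simp add: mult_ac)
      finally show ?thesis using N by (simp add: r_def abs_divide divide_right_mono)
    qed
    then have "\<bar>r 1\<bar> ^ (2 ^ k) \<le> (\<Sum>x\<in>V. \<bar>f x\<bar> * (2 * m)) / N * rate ^ (2 ^ k)" for k
      using r_pow order_trans by blast
    moreover have "(2::nat) ^ k \<ge> k" for k using less_exp[of k] by simp
    ultimately have "\<exists>t\<ge>k. \<bar>r 1\<bar> ^ t \<le> (\<Sum>x\<in>V. \<bar>f x\<bar> * (2 * m)) / N * rate ^ t" for k
      by (intro exI[of _ "2 ^ k"]) simp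
    then have "\<bar>r 1\<bar> \<le> rate"
      by (rule base_le_of_powers_le[OF abs_ge_zero rate_nonneg])
    then show ?thesis using N by (simp add: r_def flip: q1 N_def) (simp add: field_simps)
  qed
qed

lemma tv_mixing:
  assumes "\<epsilon> > 0"
  shows "tv_mixing_le V (uniform_dist V) kernel \<epsilon>
    (inv_neg_log rate * ln ((1 - 1 / real (card V)) / \<epsilon>))"
  unfolding tv_mixing_le_def
proof (intro allI impI ballI)
  fix t x assume t: "0 < t" "inv_neg_log rate * ln ((1 - 1 / real (card V)) / \<epsilon>) \<le> real t" and x: "x \<in> V"
  have "(1 - 1 / real (card V)) * rate ^ t \<le> \<epsilon>"
    using t assms card_V by (intro geometric_le_of_inv_neg_log rate_nonneg rate_less_1) auto
  then show "tv_dist V (uniform_dist V) kernel t x \<le> \<epsilon>" using tv_dist_le[OF x, of t] by linarith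
qed

end

locale two_sided_drifting = drifting V W D \<delta> for V :: "'a set" and W D \<delta> +
  assumes reversed: "drifting V (\<lambda>x y. W y x) D \<delta>"
begin

lemma linf_dist_le:
  assumes "x \<in> V"
  shows "linf_dist V (uniform_dist V) kernel t x \<le> (real (card V) - 1) * rate ^ t"
proof -
  \<comment> \<open>The reversed walk contributes only its spread at time \<open>0\<close>.\<close>
  have "linf_dist V (uniform_dist V) kernel (t + 0) x
      \<le> (sqrt (real (card V) - 1) * rate ^ t) * sqrt (real (card V) - 1)"
    using drifting.evolve_spread_le[OF reversed, of _ 0]
    by (intro linf_dist_le_spread biregular_axioms assms evolve_spread_le) auto
  also have "\<dots> = (sqrt (real (card V) - 1))\<^sup>2 * rate ^ t" by (simp add: power2_eq_square)
  finally show ?thesis using card_V by simp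
qed

text \<open>
  The two halves of the time each have to reduce the spread to \<open>y\<close>. For odd \<open>t\<close> the shorter half has
  \<open>t/2 - 1/2\<close> steps, which the slack \<open>2/3\<close> in \<open>mean_spread_le\<close> covers.
\<close>

lemma linf_dist_le_potential:
  assumes x: "x \<in> V" and y: "y > 0" and t: "2 * (real (card V)^2 / \<delta> * potential y) \<le> real t"
  shows "linf_dist V (uniform_dist V) kernel t x \<le> y\<^sup>2"
proof -
  define r where "r = t div 2"
  have "real t \<le> 2 * real r + 1" unfolding r_def by linarith
  then have r: "real (card V)^2 / \<delta> * potential y < real r + 2/3" using t by linarith
  then have s: "real (card V)^2 / \<delta> * potential y < real (t - r) + 2/3"
    by (simp add: r_def)
  have "linf_dist V (uniform_dist V) kernel (t - r + r) x \<le> y * y"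
    using mean_spread_le[OF x y s] drifting.mean_spread_le[OF reversed _ y r]
    by (intro linf_dist_le_spread biregular_axioms x)
      (auto simp: mean_spread_def drifting.mean_spread_def[OF reversed])
  then show ?thesis by (simp add: r_def power2_eq_square)
qed

lemma linf_mixing:
  assumes e: "\<epsilon> > 0"
  shows "linf_mixing_le V (uniform_dist V) kernel \<epsilon>
    (if \<epsilon> \<le> 1
     then min ((ln (real (card V) - 1) + ln (1 / \<epsilon>)) * inv_neg_log rate)
       (real (card V)^2 / \<delta> / 3 + real (card V)^2 / \<delta> / 4 * ln (1 / \<epsilon>))
     else real (card V)^2 / \<delta> * (2/3) * ((1 + 3 * \<epsilon>) / (1 + \<epsilon>)^3))"
  (is "linf_mixing_le _ _ _ _ (if _ then min ?g ?p else ?q)")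
  unfolding linf_mixing_le_def
proof (intro allI impI ballI)
  fix t x assume t: "0 < t" "(if \<epsilon> \<le> 1 then min ?g ?p else ?q) \<le> real t" and x: "x \<in> V"
  have sq: "(sqrt \<epsilon>)\<^sup>2 = \<epsilon>" "sqrt \<epsilon> > 0" using e by auto
  let ?K = "2 * (real (card V)^2 / \<delta> * potential (sqrt \<epsilon>))"
  show "linf_dist V (uniform_dist V) kernel t x \<le> \<epsilon>"
  proof (cases "\<epsilon> \<le> 1 \<and> ?g \<le> real t")
    case True
    have "ln (real (card V) - 1) + ln (1 / \<epsilon>) = ln ((real (card V) - 1) / \<epsilon>)"
      using card_V e by (simp add: ln_div)
    then have "(real (card V) - 1) * rate ^ t \<le> \<epsilon>"
      using t True e card_V
      by (intro geometric_le_of_inv_neg_log rate_nonneg rate_less_1) (auto simp: mult.commute)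
    then show ?thesis using linf_dist_le[OF x, of t] by linarith
  next
    case False
    have "?K = (if \<epsilon> \<le> 1 then ?p else ?q)"
    proof (cases "\<epsilon> \<le> 1")
      case True
      then have "potential (sqrt \<epsilon>) = 1/6 + ln (1 / \<epsilon>) / 8"
        using e by (simp add: potential_def ln_sqrt ln_div)
      then show ?thesis using True by (simp add: algebra_simps)
    next
      case False
      then show ?thesis by (simp add: potential_def sq)
    qed
    then have "?K \<le> real t" using False t by (auto split: if_splits simp: min_def)
    then show ?thesis using linf_dist_le_potential[OF x sq(2)] sq(1) by simp
  qed
qed

end

section \<open>Sources of drift\<close>

context biregular
begin

text \<open>
  If every state keeps at least half of its mass, low thresholds retain all of \<open>A\<close> and high ones admit
  nothing from outside. The positive part of the change in size then counts the states entered from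
  outside, and its sum over the thresholds is the flow out of \<open>A\<close>.
\<close>

lemma drift_of_heavy_loops:
  assumes A: "A \<subseteq> V" and loops: "\<And>y. y \<in> V \<Longrightarrow> D \<le> 2 * W y y"
    and flow: "m \<le> (\<Sum>x\<in>A. \<Sum>y\<in>V - A. W x y)"
  shows "real m \<le> (\<Sum>j=1..D. real (card (level A j) - card A))"
proof -
  have fin: "finite A" using A by (rule finite_subset_V)
  have "card (level A j - A) \<le> card (level A j) - card A" for j
  proof (cases "2 * j \<le> D")
    case True
    have "A \<subseteq> level A j"
    proof
      fix y assume y: "y \<in> A"
      then have "W y y \<le> inflow A y" unfolding inflow_def using fin by (intro member_le_sum) auto
      then show "y \<in> level A j" using loops[of y] True y A by (auto simp: level_def)
    qed
    then show ?thesis using fin by (simp add: card_Diff_subset)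
  next
    case False
    have "inflow A y < j" if "y \<in> V - A" for y
    proof -
      have "W y y \<le> inflow (V - A) y"
        unfolding inflow_def using finite_V that by (intro member_le_sum) auto
      then show ?thesis using inflow_complement[OF A, of y] loops[of y] that False by auto
    qed
    then have "level A j - A = {}" by (force simp: level_def)
    then show ?thesis by (simp only: card.empty le0)
  qed
  then have "(\<Sum>j=1..D. real (card (level A j - A)))
      \<le> (\<Sum>j=1..D. real (card (level A j) - card A))"
    by (intro sum_mono) simp
  moreover have "(\<Sum>j=1..D. real (card (level A j - A))) = real (\<Sum>x\<in>A. \<Sum>y\<in>V - A. W x y)"
  proof -
    have "(\<Sum>j=1..D. real (card (level A j - A))) = (\<Sum>j=1..D. \<Sum>y\<in>level A j. if y \<in> A then 0 else 1)"
    proof (intro sum.cong refl)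
      fix j
      have "(\<Sum>y\<in>level A j. if y \<in> A then 0 else 1) = (\<Sum>y\<in>level A j - A. (1::real))"
        using finite_subset_V[OF level_subset] by (intro sum.mono_neutral_cong_right) auto
      then show "real (card (level A j - A)) = (\<Sum>y\<in>level A j. if y \<in> A then 0 else 1)" by simp
    qed
    also have "\<dots> = (\<Sum>y\<in>V. real (inflow A y) * (if y \<in> A then 0 else 1))"
      by (rule sum_levels[OF A])
    also have "\<dots> = (\<Sum>y\<in>V - A. real (inflow A y))"
      using finite_V by (intro sum.mono_neutral_cong_right) auto
    also have "\<dots> = real (\<Sum>y\<in>V - A. \<Sum>x\<in>A. W x y)"
      by (simp add: inflow_def)
    also have "(\<Sum>y\<in>V - A. \<Sum>x\<in>A. W x y) = (\<Sum>x\<in>A. \<Sum>y\<in>V - A. W x y)"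
      by (rule sum.swap)
    finally show ?thesis .
  qed
  moreover have "real m \<le> real (\<Sum>x\<in>A. \<Sum>y\<in>V - A. W x y)" using flow by (simp only: of_nat_le_iff)
  ultimately show ?thesis by linarith
qed

lemma level_complement:
  assumes A: "A \<subseteq> V" and j: "1 \<le> j" "j \<le> D"
  shows "level (V - A) (D + 1 - j) = V - level A j"
proof -
  have "D + 1 - j \<le> inflow (V - A) y \<longleftrightarrow> \<not> j \<le> inflow A y" if "y \<in> V" for y
    using inflow_complement[OF A that] j by linarith
  then show ?thesis by (auto simp: level_def)
qed

text \<open>
  For a small set the lowest threshold alone yields growth by one. The complement of a large set is
  small, and the complement evolves as the complements of the levels; growth there is a loss for the
  large set, which the martingale property turns into an equal expected gain.
\<close>

lemma drift_of_expansion: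
  assumes exp: "\<And>A. \<lbrakk>A \<subseteq> V; A \<noteq> {}; 2 * card A \<le> card V\<rbrakk> \<Longrightarrow> card A < card (level A 1)"
    and A: "A \<subseteq> V" "A \<noteq> {}" "A \<noteq> V"
  shows "1 \<le> (\<Sum>j=1..D. real (card (level A j) - card A))"
proof -
  have small: "1 \<le> (\<Sum>j=1..D. real (card (level B j) - card B))"
    if B: "B \<subseteq> V" "B \<noteq> {}" "2 * card B \<le> card V" for B
  proof -
    have "1 \<le> real (card (level B 1) - card B)" using exp[OF B] by linarith
    also have "\<dots> \<le> (\<Sum>j=1..D. real (card (level B j) - card B))"
      using D_pos by (intro member_le_sum) auto
    finally show ?thesis .
  qed
  show ?thesis
  proof (cases "2 * card A \<le> card V")
    case True
    then show ?thesis using small A by blast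
  next
    case False
    let ?B = "V - A"
    have card_compl: "card (V - S) = card V - card S" if "S \<subseteq> V" for S
      using that finite_subset_V by (simp add: card_Diff_subset)
    have "1 \<le> (\<Sum>j=1..D. real (card (level ?B j) - card ?B))"
      using A False card_compl[OF A(1)] by (intro small) auto
    also have "\<dots> = (\<Sum>j=1..D. real (card (level ?B (D + 1 - j)) - card ?B))"
      by (rule sum.atLeastAtMost_rev)
    also have "\<dots> = (\<Sum>j=1..D. real (card A - card (level A j)))"
    proof (intro sum.cong refl)
      fix j assume "j \<in> {1..D}"
      then have "card (level ?B (D + 1 - j)) = card V - card (level A j)"
        using level_complement[OF A(1), of j] card_compl[OF level_subset] by simp
      then show "real (card (level ?B (D + 1 - j)) - card ?B) = real (card A - card (level A j))"
        using card_compl[OF A(1)] card_le_V[OF A(1)] card_le_V[OF level_subset[of A j]] by simp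
    qed
    also have "\<dots> = (\<Sum>j=1..D. real (card (level A j) - card A))"
    proof -
      have "(\<Sum>j=1..D. real (card (level A j) - card A)) - (\<Sum>j=1..D. real (card A - card (level A j)))
          = (\<Sum>j=1..D. real (card (level A j)) - real (card A))"
        by (simp only: sum_subtractf[symmetric]) (rule sum.cong, auto)
      also have "\<dots> = 0" using sum_card_levels[OF A(1)] by (simp add: sum_subtractf)
      finally show ?thesis by simp
    qed
    finally show ?thesis .
  qed
qed

lemma level_1_eq_nbrs:
  assumes "A \<subseteq> V"
  shows "level A 1 = nbrs V kernel A"
proof -
  have "0 < inflow A y \<longleftrightarrow> (\<exists>x\<in>A. 0 < W x y)" for y
    using finite_subset_V[OF assms] by (simp add: inflow_def neq0_conv[symmetric] del: neq0_conv)
  then show ?thesis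
    using D_pos by (auto simp: level_def nbrs_def kernel_def zero_less_divide_iff Suc_le_eq)
qed

text \<open>
  If the set \<open>B\<close> of predecessors of \<open>A\<close> were no larger than \<open>A\<close>, the rows of \<open>B\<close> could only just supply the
  column sums of \<open>A\<close>, leaving nothing for other columns. Then all successors of \<open>B\<close> would lie in \<open>A\<close>,
  which contradicts expansion of \<open>B\<close>.
\<close>

lemma expansion_reversed:
  assumes exp: "\<And>A. \<lbrakk>A \<subseteq> V; A \<noteq> {}; 2 * card A \<le> card V\<rbrakk> \<Longrightarrow> card A < card (level A 1)"
    and A: "A \<subseteq> V" "A \<noteq> {}" "2 * card A \<le> card V"
  shows "card A < card (biregular.level V (\<lambda>x y. W y x) A 1)"
proof (rule ccontr)
  interpret rev: biregular V "\<lambda>x y. W y x" D by (rule transpose)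
  let ?B = "rev.level A 1"
  assume "\<not> card A < card ?B"
  then have le: "card ?B \<le> card A" by simp
  have BV: "?B \<subseteq> V" by (rule rev.level_subset)
  have fin: "finite A" "finite ?B" using A BV finite_subset_V by auto
  have zero: "W x y = 0" if "x \<in> V - ?B" "y \<in> A" for x y
    using that fin(1) by (auto simp: rev.level_def rev.inflow_def not_le Suc_le_eq)
  have into_A: "(\<Sum>x\<in>?B. \<Sum>y\<in>A. W x y) = card A * D"
  proof -
    have "(\<Sum>x\<in>?B. \<Sum>y\<in>A. W x y) = (\<Sum>x\<in>V. \<Sum>y\<in>A. W x y)"
      using BV finite_V zero by (intro sum.mono_neutral_left) auto
    also have "\<dots> = (\<Sum>y\<in>A. \<Sum>x\<in>V. W x y)" by (rule sum.swap)
    finally show ?thesis using A(1) by (simp add: col_sum subset_iff)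
  qed
  have from_B: "(\<Sum>x\<in>?B. \<Sum>y\<in>V. W x y) = card ?B * D"
    using BV by (simp add: row_sum subset_iff)
  have split: "(\<Sum>x\<in>?B. \<Sum>y\<in>V. W x y) = (\<Sum>x\<in>?B. \<Sum>y\<in>V - A. W x y) + (\<Sum>x\<in>?B. \<Sum>y\<in>A. W x y)"
    unfolding sum.distrib[symmetric]
    by (intro sum.cong refl) (rule sum.subset_diff[OF A(1) finite_V])
  have "card A * D \<le> card ?B * D" using split into_A from_B by linarith
  then have eq: "card ?B = card A" using le D_pos by simp
  have "(\<Sum>x\<in>?B. \<Sum>y\<in>V - A. W x y) = 0" using split into_A from_B eq by simp
  then have "\<And>x y. \<lbrakk>x \<in> ?B; y \<in> V - A\<rbrakk> \<Longrightarrow> W x y = 0"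
    using fin finite_V by simp
  then have "inflow ?B y = 0" if "y \<in> V - A" for y
    using that by (simp add: inflow_def)
  then have "level ?B 1 \<subseteq> A" by (force simp: level_def)
  then have "card (level ?B 1) \<le> card ?B" using eq card_mono[OF fin(1)] by simp
  moreover have "card ?B < card (level ?B 1)"
    using A eq fin by (intro exp BV) auto
  ultimately show False by simp
qed

end

lemma two_sided_drifting_of_expansion:
  assumes "biregular V W D" and two: "card V \<ge> 2"
    and exp: "\<And>A. \<lbrakk>A \<subseteq> V; A \<noteq> {}; 2 * card A \<le> card V\<rbrakk>
      \<Longrightarrow> card A < card (nbrs V (biregular.kernel W D) A)"
  shows "two_sided_drifting V W D (1 / real D)"
proof -
  interpret biregular V W D by fact
  interpret rev: biregular V "\<lambda>x y. W y x" D by (rule transpose)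
  have exp': "card A < card (level A 1)" if "A \<subseteq> V" "A \<noteq> {}" "2 * card A \<le> card V" for A
    using exp[OF that] that(1) by (simp add: level_1_eq_nbrs del: One_nat_def)
  show ?thesis
  proof unfold_locales
    fix A assume A: "A \<subseteq> V" "A \<noteq> {}" "A \<noteq> V"
    show "1 / real D * real D \<le> (\<Sum>j=1..D. real (card (level A j) - card A))"
      using drift_of_expansion[OF exp' A] D_pos by simp
    show "1 / real D * real D \<le> (\<Sum>j=1..D. real (card (rev.level A j) - card A))"
      using rev.drift_of_expansion[OF expansion_reversed[OF exp'] A] D_pos by simp
  qed (use two D_pos in auto)
qed

definition lazy_weight :: "nat \<Rightarrow> ('a \<Rightarrow> 'a \<Rightarrow> nat) \<Rightarrow> 'a \<Rightarrow> 'a \<Rightarrow> nat" where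
  "lazy_weight D W x y = W x y + (if x = y then D else 0)"

lemma biregular_lazy:
  assumes "biregular V W D"
  shows "biregular V (lazy_weight D W) (2 * D)"
proof -
  interpret biregular V W D by fact
  show ?thesis
    by unfold_locales (auto simp: finite_V D_pos lazy_weight_def sum.distrib row_sum col_sum)
qed

text \<open>
  At least one arc leaves each proper set \<open>A\<close>, and applied to the complement of \<open>A\<close> the same fact provides
  an arc into \<open>A\<close>, as the reversed walk requires.
\<close>

lemma two_sided_drifting_lazy:
  assumes bireg: "biregular V W D" and two: "card V \<ge> 2"
    and flow: "\<And>A. \<lbrakk>A \<subseteq> V; A \<noteq> {}; A \<noteq> V\<rbrakk> \<Longrightarrow> 1 \<le> (\<Sum>x\<in>A. \<Sum>y\<in>V - A. W x y)"
  shows "two_sided_drifting V (lazy_weight D W) (2 * D) (1 / real (2 * D))"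
proof -
  interpret biregular V W D by fact
  interpret L: biregular V "lazy_weight D W" "2 * D" using bireg by (rule biregular_lazy)
  interpret rev: biregular V "\<lambda>x y. lazy_weight D W y x" "2 * D" by (rule L.transpose)
  have off: "(\<Sum>x\<in>A. \<Sum>y\<in>V - A. lazy_weight D W x y) = (\<Sum>x\<in>A. \<Sum>y\<in>V - A. W x y)"
    "(\<Sum>x\<in>A. \<Sum>y\<in>V - A. lazy_weight D W y x) = (\<Sum>x\<in>A. \<Sum>y\<in>V - A. W y x)" for A
    by (auto intro!: sum.cong simp: lazy_weight_def)
  show ?thesis
  proof unfold_locales
    fix A assume A: "A \<subseteq> V" "A \<noteq> {}" "A \<noteq> V"
    have "1 \<le> (\<Sum>x\<in>A. \<Sum>y\<in>V - A. lazy_weight D W x y)" unfolding off by (rule flow[OF A])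
    then have "real 1 \<le> (\<Sum>j=1..2*D. real (card (L.level A j) - card A))"
      by (intro L.drift_of_heavy_loops[OF A(1)]) (simp add: lazy_weight_def)
    then show "1 / real (2 * D) * real (2 * D) \<le> (\<Sum>j=1..2*D. real (card (L.level A j) - card A))"
      using D_pos by simp
    have "1 \<le> (\<Sum>x\<in>V - A. \<Sum>y\<in>V - (V - A). W x y)" using A by (intro flow) auto
    also have "V - (V - A) = A" using A by auto
    also have "(\<Sum>x\<in>V - A. \<Sum>y\<in>A. W x y) = (\<Sum>x\<in>A. \<Sum>y\<in>V - A. W y x)" by (rule sum.swap)
    finally have "real 1 \<le> (\<Sum>j=1..2*D. real (card (rev.level A j) - card A))"
      unfolding off(2)[symmetric]
      by (intro rev.drift_of_heavy_loops[OF A(1)]) (simp add: lazy_weight_def)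
    then show "1 / real (2 * D) * real (2 * D) \<le> (\<Sum>j=1..2*D. real (card (rev.level A j) - card A))"
      using D_pos by simp
  qed (use two D_pos in auto)
qed

section \<open>The spectral gap\<close>

text \<open>
  The quadratic form of \<open>P\<close> is that of its symmetrisation. Making the symmetrised walk lazy provides heavy
  loops, so its drift is the flow out of a set: at least \<open>2\<close> units out of \<open>4 D\<close>, one for leaving and one
  for entering the set in the original direction. Laziness halves the gap, and undoing it doubles the bound.
\<close>

lemma quadratic_form_le_of_flow:
  fixes f :: "'a \<Rightarrow> real"
  assumes bireg: "biregular V W D" and two: "card V \<ge> 2"
    and flow: "\<And>A. \<lbrakk>A \<subseteq> V; A \<noteq> {}; A \<noteq> V\<rbrakk> \<Longrightarrow> 1 \<le> (\<Sum>x\<in>A. \<Sum>y\<in>V - A. W x y)"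
    and sum0: "(\<Sum>x\<in>V. f x) = 0"
  shows "2 / real D * (1 - cos (pi / card V)) * (\<Sum>x\<in>V. (f x)\<^sup>2)
    \<le> (\<Sum>x\<in>V. (f x)\<^sup>2) - (\<Sum>x\<in>V. \<Sum>y\<in>V. f x * biregular.kernel W D x y * f y)"
proof -
  interpret biregular V W D by fact
  \<comment> \<open>In terms of kernels, half the identity plus a quarter of \<open>P\<close> and a quarter of its transpose.\<close>
  define H where "H = lazy_weight (2 * D) (\<lambda>x y. W x y + W y x)"
  have "biregular V (\<lambda>x y. W x y + W y x) (2 * D)"
    by unfold_locales (auto simp: finite_V D_pos sum.distrib row_sum col_sum)
  then have bH: "biregular V H (2 * (2 * D))" unfolding H_def by (rule biregular_lazy)
  interpret H: biregular V H "2 * (2 * D)" by (rule bH)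
  interpret H: drifting V H "2 * (2 * D)" "1 / real (2 * D)"
  proof unfold_locales
    fix A assume A: "A \<subseteq> V" "A \<noteq> {}" "A \<noteq> V"
    have "1 \<le> (\<Sum>x\<in>V - A. \<Sum>y\<in>V - (V - A). W x y)" using A by (intro flow) auto
    also have "V - (V - A) = A" using A by auto
    also have "(\<Sum>x\<in>V - A. \<Sum>y\<in>A. W x y) = (\<Sum>x\<in>A. \<Sum>y\<in>V - A. W y x)" by (rule sum.swap)
    finally have "2 \<le> (\<Sum>x\<in>A. \<Sum>y\<in>V - A. W x y + W y x)"
      using flow[OF A] by (simp add: sum.distrib)
    also have "\<dots> = (\<Sum>x\<in>A. \<Sum>y\<in>V - A. H x y)"
      by (auto intro!: sum.cong simp: H_def lazy_weight_def)
    finally have "real 2 \<le> (\<Sum>j=1..2 * (2 * D). real (card (H.level A j) - card A))"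
      by (intro H.drift_of_heavy_loops[OF A(1)]) (simp add: H_def lazy_weight_def)
    then show "1 / real (2 * D) * real (2 * (2 * D))
        \<le> (\<Sum>j=1..2 * (2 * D). real (card (H.level A j) - card A))"
      using D_pos by simp
  qed (use two D_pos in auto)
  have kernel_H: "H.kernel x y
      = (real (W x y) + real (W y x) + (if x = y then 2 * real D else 0)) / (4 * real D)" for x y
    unfolding H.kernel_def by (simp add: H_def lazy_weight_def)
  have sym: "H x y = H y x" for x y by (simp add: H_def lazy_weight_def)
  have "(\<Sum>x\<in>V. \<Sum>y\<in>V. f x * H.kernel x y * f y)
      = (1/2) * (\<Sum>x\<in>V. (f x)\<^sup>2) + (1/2) * (\<Sum>x\<in>V. \<Sum>y\<in>V. f x * kernel x y * f y)"
  proof -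
    have "f x * H.kernel x y * f y = (1/4) * (f x * kernel x y * f y) + (1/4) * (f y * kernel y x * f x)
        + (1/2) * (if x = y then (f x)\<^sup>2 else 0)" for x y
      unfolding kernel_H kernel_def using D_pos by (simp add: field_simps power2_eq_square)
    then have "(\<Sum>x\<in>V. \<Sum>y\<in>V. f x * H.kernel x y * f y)
        = (1/4) * (\<Sum>x\<in>V. \<Sum>y\<in>V. f x * kernel x y * f y)
          + (1/4) * (\<Sum>x\<in>V. \<Sum>y\<in>V. f y * kernel y x * f x)
          + (1/2) * (\<Sum>x\<in>V. \<Sum>y\<in>V. if x = y then (f x)\<^sup>2 else 0)"
      by (simp only: sum.distrib sum_distrib_left)
    moreover have "(\<Sum>x\<in>V. \<Sum>y\<in>V. f y * kernel y x * f x) = (\<Sum>x\<in>V. \<Sum>y\<in>V. f x * kernel x y * f y)"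
      by (rule sum.swap)
    moreover have "(\<Sum>x\<in>V. \<Sum>y\<in>V. if x = y then (f x)\<^sup>2 else 0) = (\<Sum>x\<in>V. (f x)\<^sup>2)"
      using finite_V by simp
    ultimately show ?thesis by simp
  qed
  then have "(1/2) * (\<Sum>x\<in>V. (f x)\<^sup>2) + (1/2) * (\<Sum>x\<in>V. \<Sum>y\<in>V. f x * kernel x y * f y)
      \<le> H.rate * (\<Sum>x\<in>V. (f x)\<^sup>2)"
    using H.symmetric_quadratic_form_le[OF sym sum0] by simp
  moreover have "H.rate * (\<Sum>x\<in>V. (f x)\<^sup>2)
      = (\<Sum>x\<in>V. (f x)\<^sup>2) - 1 / real D * (1 - cos (pi / card V)) * (\<Sum>x\<in>V. (f x)\<^sup>2)"
  proof -
    have rate: "H.rate = 1 - 1 / real D * (1 - cos (pi / card V))"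
      unfolding H.rate_def by simp
    show ?thesis unfolding rate by (simp only: left_diff_distrib mult_1)
  qed
  moreover have "2 / real D * (1 - cos (pi / card V)) * (\<Sum>x\<in>V. (f x)\<^sup>2)
      = 2 * (1 / real D * (1 - cos (pi / card V)) * (\<Sum>x\<in>V. (f x)\<^sup>2))"
    by simp
  ultimately show ?thesis by linarith
qed

text \<open>
  Subtracting the mean from \<open>f\<close> changes neither the numerator nor the denominator of the Rayleigh
  quotient, both of which are Dirichlet forms of doubly stochastic matrices.
\<close>

lemma spectral_gap_uniform_ge:
  fixes P :: "'a \<Rightarrow> 'a \<Rightarrow> real"
  assumes fin: "finite V" and two: "card V \<ge> 2"
    and rows: "\<And>x. x \<in> V \<Longrightarrow> (\<Sum>y\<in>V. P x y) = 1" and cols: "\<And>y. y \<in> V \<Longrightarrow> (\<Sum>x\<in>V. P x y) = 1"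
    and gap: "\<And>g. (\<Sum>x\<in>V. g x) = 0 \<Longrightarrow>
      c * (\<Sum>x\<in>V. (g x)\<^sup>2) \<le> (\<Sum>x\<in>V. (g x)\<^sup>2) - (\<Sum>x\<in>V. \<Sum>y\<in>V. g x * P x y * g y)"
  shows "c \<le> spectral_gap V (uniform_dist V) P"
  unfolding spectral_gap_def
proof (rule cINF_greatest)
  define n where "n = real (card V)"
  have n: "n \<ge> 2" using two by (simp add: n_def)
  have var: "variance V (uniform_dist V) f = (\<Sum>x\<in>V. (f x - (\<Sum>y\<in>V. f y) / n)\<^sup>2) / n" for f
    by (simp add: variance_def uniform_dist_def n_def flip: sum_divide_distrib)
  obtain u where u: "u \<in> V" using two by fastforce
  show "{f. variance V (uniform_dist V) f \<noteq> 0} \<noteq> {}"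
  proof -
    let ?f = "\<lambda>x. if x = u then 1 else 0 :: real"
    have "0 < (?f u - (\<Sum>y\<in>V. ?f y) / n)\<^sup>2" using u fin n by (simp add: field_simps)
    also have "\<dots> \<le> (\<Sum>x\<in>V. (?f x - (\<Sum>y\<in>V. ?f y) / n)\<^sup>2)"
      using fin u by (intro member_le_sum) auto
    finally have "variance V (uniform_dist V) ?f \<noteq> 0" unfolding var using n by simp
    then show ?thesis by blast
  qed
  fix f assume f: "f \<in> {f. variance V (uniform_dist V) f \<noteq> 0}"
  define g where "g = (\<lambda>x. f x - (\<Sum>y\<in>V. f y) / n)"
  define N where "N = (\<Sum>x\<in>V. (g x)\<^sup>2)"
  have sum0: "(\<Sum>x\<in>V. g x) = 0" using n by (simp add: g_def sum_subtractf n_def)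
  have "N \<noteq> 0" using f n unfolding N_def g_def by (simp add: var)
  then have N: "N > 0" using sum_nonneg[of V "\<lambda>x. (g x)\<^sup>2"] by (simp add: N_def less_le)
  have diff: "f x - f y = g x - g y" for x y by (simp add: g_def)
  have dir: "(1/2 * (\<Sum>x\<in>V. \<Sum>y\<in>V. (f x - f y)\<^sup>2 * uniform_dist V x * Q x y))
      = (N - (\<Sum>x\<in>V. \<Sum>y\<in>V. g x * Q x y * g y)) / n"
    if "\<And>x. x \<in> V \<Longrightarrow> (\<Sum>y\<in>V. Q x y) = 1" "\<And>y. y \<in> V \<Longrightarrow> (\<Sum>x\<in>V. Q x y) = 1" for Q
  proof -
    have "(\<Sum>x\<in>V. \<Sum>y\<in>V. (f x - f y)\<^sup>2 * uniform_dist V x * Q x y)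
        = (\<Sum>x\<in>V. \<Sum>y\<in>V. (g x - g y)\<^sup>2 * Q x y) / n"
      by (simp add: diff uniform_dist_def n_def sum_divide_distrib)
    also have "\<dots> = (2 * N - 2 * (\<Sum>x\<in>V. \<Sum>y\<in>V. g x * Q x y * g y)) / n"
      unfolding N_def by (simp only: dirichlet_form_doubly_stochastic[OF that])
    finally have eq: "(\<Sum>x\<in>V. \<Sum>y\<in>V. (f x - f y)\<^sup>2 * uniform_dist V x * Q x y)
        = (2 * N - 2 * (\<Sum>x\<in>V. \<Sum>y\<in>V. g x * Q x y * g y)) / n" .
    have "1/2 * ((2 * N - 2 * q) / n) = (N - q) / n" for q by (simp add: diff_divide_distrib)
    then show ?thesis unfolding eq .
  qed
  have den: "(1/2 * (\<Sum>x\<in>V. \<Sum>y\<in>V. (f x - f y)\<^sup>2 * uniform_dist V x * uniform_dist V y)) = N / n"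
  proof -
    have "(\<Sum>x\<in>V. \<Sum>y\<in>V. g x * uniform_dist V y * g y) = (\<Sum>x\<in>V. g x * (\<Sum>y\<in>V. g y) / n)"
      by (simp add: uniform_dist_def n_def sum_distrib_left sum_divide_distrib)
    also have "\<dots> = 0" by (simp add: sum0)
    finally show ?thesis using two by (subst dir) (auto simp: uniform_dist_def)
  qed
  have num: "(1/2 * (\<Sum>x\<in>V. \<Sum>y\<in>V. (f x - f y)\<^sup>2 * uniform_dist V x * P x y))
      = (N - (\<Sum>x\<in>V. \<Sum>y\<in>V. g x * P x y * g y)) / n"
    by (rule dir) (fact rows, fact cols)
  show "c \<le> (1/2 * (\<Sum>x\<in>V. \<Sum>y\<in>V. (f x - f y)\<^sup>2 * uniform_dist V x * P x y))
      / (1/2 * (\<Sum>x\<in>V. \<Sum>y\<in>V. (f x - f y)\<^sup>2 * uniform_dist V x * uniform_dist V y))"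
    unfolding den num using gap[OF sum0] N n
    by (simp add: N_def[symmetric] le_divide_eq)
qed

section \<open>The max-degree walk on an Eulerian digraph\<close>

text \<open>
  The padding on the diagonal makes all row and column sums equal to the maximum degree.
\<close>

definition arc_weight :: "('a, 'b) pre_digraph \<Rightarrow> 'a \<Rightarrow> 'a \<Rightarrow> nat" where
  "arc_weight G x y = card {e \<in> arcs G. tail G e = x \<and> head G e = y}
    + (if x = y then max_degree G - out_degree G x else 0)"

context
  fixes G :: "('a, 'b) pre_digraph"
  assumes eul: "eulerian_digraph G" and two: "card (verts G) \<ge> 2"
begin

interpretation fin_digraph G
  using eul by (simp add: eulerian_digraph_def)

lemma max_degree_walk_eq_arc_weight:
  "max_degree_walk G x y = real (arc_weight G x y) / real (max_degree G)"
proof -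
  have "out_degree G x \<le> max_degree G"
  proof (cases "x \<in> verts G")
    case True
    then show ?thesis unfolding max_degree_def by (intro Max_ge) auto
  next
    case False
    then have "out_arcs G x = {}" by (auto simp: out_arcs_def)
    then show ?thesis by (simp add: out_degree_def)
  qed
  then show ?thesis
    using eulerian_max_degree_pos[OF eul two]
    by (cases "x = y")
      (auto simp: max_degree_walk_def arc_weight_def of_nat_diff add_divide_distrib diff_divide_distrib)
qed

lemma biregular_arc_weight: "biregular (verts G) (arc_weight G) (max_degree G)"
proof
  let ?d = "max_degree G"
  show d: "0 < ?d" by (rule eulerian_max_degree_pos[OF eul two])
  fix x assume x: "x \<in> verts G"
  have "real (\<Sum>y\<in>verts G. arc_weight G x y) / real ?d = 1"
    using max_degree_walk_row_sum[OF eul two x]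
    by (simp add: max_degree_walk_eq_arc_weight flip: sum_divide_distrib)
  then have "real (\<Sum>y\<in>verts G. arc_weight G x y) = real ?d" using d by (simp add: divide_eq_1_iff)
  then show "(\<Sum>y\<in>verts G. arc_weight G x y) = ?d" by (simp only: of_nat_eq_iff)
  have "real (\<Sum>y\<in>verts G. arc_weight G y x) / real ?d = 1"
    using max_degree_walk_column_sum[OF eul two x]
    by (simp add: max_degree_walk_eq_arc_weight flip: sum_divide_distrib)
  then have "real (\<Sum>y\<in>verts G. arc_weight G y x) = real ?d" using d by (simp add: divide_eq_1_iff)
  then show "(\<Sum>y\<in>verts G. arc_weight G y x) = ?d" by (simp only: of_nat_eq_iff)
qed simp

lemma kernel_arc_weight: "biregular.kernel (arc_weight G) (max_degree G) = max_degree_walk G"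
  by (simp add: fun_eq_iff max_degree_walk_eq_arc_weight biregular.kernel_def[OF biregular_arc_weight])

lemma kernel_lazy_weight:
  "biregular.kernel (lazy_weight (max_degree G) (arc_weight G)) (2 * max_degree G)
    = lazy (max_degree_walk G)"
  unfolding fun_eq_iff biregular.kernel_def[OF biregular_lazy[OF biregular_arc_weight]]
  using eulerian_max_degree_pos[OF eul two]
  by (simp add: max_degree_walk_eq_arc_weight lazy_def lazy_weight_def field_simps)

lemma arc_weight_flow_pos:
  assumes A: "A \<subseteq> verts G" "A \<noteq> {}" "A \<noteq> verts G"
  shows "1 \<le> (\<Sum>x\<in>A. \<Sum>y\<in>verts G - A. arc_weight G x y)"
proof -
  obtain u v where uv: "u \<in> A" "v \<in> verts G - A" using A by auto
  then have reach: "u \<rightarrow>\<^sup>*\<^bsub>G\<^esub> v" using eul A(1) by (auto simp: eulerian_digraph_def strongly_connected_def)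
  have "\<exists>x\<in>A. \<exists>y\<in>verts G - A. x \<rightarrow>\<^bsub>G\<^esub> y"
  proof (rule ccontr)
    assume closed: "\<not> ?thesis"
    from reach have "u \<in> A \<longrightarrow> v \<in> A"
    proof (induct rule: converse_reachable_induct)
      case (step x y)
      then show ?case using closed adj_in_verts(2)[OF step(1)] by blast
    qed simp
    then show False using uv by simp
  qed
  then obtain x y where xy: "x \<in> A" "y \<in> verts G - A" "x \<rightarrow>\<^bsub>G\<^esub> y" by blast
  then have "{e \<in> arcs G. tail G e = x \<and> head G e = y} \<noteq> {}" by (auto simp: arcs_ends_conv)
  then have "1 \<le> arc_weight G x y"
    by (auto simp: arc_weight_def Suc_le_eq card_gt_0_iff intro: trans_less_add1)
  also have "\<dots> \<le> (\<Sum>y\<in>verts G - A. arc_weight G x y)"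
    using xy by (intro member_le_sum) auto
  also have "\<dots> \<le> (\<Sum>x\<in>A. \<Sum>y\<in>verts G - A. arc_weight G x y)"
    using xy finite_subset[OF A(1)] by (intro member_le_sum) auto
  finally show ?thesis .
qed

lemma max_degree_walk_quadratic_form:
  assumes "(\<Sum>x\<in>verts G. f x) = 0"
  shows "2 / real (max_degree G) * (1 - cos (pi / card (verts G))) * (\<Sum>x\<in>verts G. (f x)\<^sup>2)
    \<le> (\<Sum>x\<in>verts G. (f x)\<^sup>2) - (\<Sum>x\<in>verts G. \<Sum>y\<in>verts G. f x * max_degree_walk G x y * f y)"
  using quadratic_form_le_of_flow[OF biregular_arc_weight two arc_weight_flow_pos assms]
  by (simp add: kernel_arc_weight)

lemma spectral_gap_max_degree_walk:
  "2 / real (max_degree G) * (1 - cos (pi / card (verts G)))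
    \<le> spectral_gap (verts G) (uniform_dist (verts G)) (max_degree_walk G)"
  by (rule spectral_gap_uniform_ge[OF finite_verts two max_degree_walk_row_sum[OF eul two]
        max_degree_walk_column_sum[OF eul two] max_degree_walk_quadratic_form])

lemma spectral_gap_lazy_max_degree_walk:
  "1 / real (max_degree G) * (1 - cos (pi / card (verts G)))
    \<le> spectral_gap (verts G) (uniform_dist (verts G)) (lazy (max_degree_walk G))"
proof (rule spectral_gap_uniform_ge)
  interpret biregular "verts G" "lazy_weight (max_degree G) (arc_weight G)" "2 * max_degree G"
    by (rule biregular_lazy[OF biregular_arc_weight])
  show "(\<Sum>y\<in>verts G. lazy (max_degree_walk G) x y) = 1" if "x \<in> verts G" for x
    using kernel_row_sum[OF that] by (simp add: kernel_lazy_weight)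
  show "(\<Sum>x\<in>verts G. lazy (max_degree_walk G) x y) = 1" if "y \<in> verts G" for y
    using kernel_column_sum[OF that] by (simp add: kernel_lazy_weight)
  fix g :: "'a \<Rightarrow> real" assume sum0: "(\<Sum>x\<in>verts G. g x) = 0"
  have "g x * lazy (max_degree_walk G) x y * g y
      = 1/2 * (if x = y then (g x)\<^sup>2 else 0) + 1/2 * (g x * max_degree_walk G x y * g y)" for x y
    by (simp add: lazy_def field_simps power2_eq_square)
  then have "(\<Sum>x\<in>verts G. \<Sum>y\<in>verts G. g x * lazy (max_degree_walk G) x y * g y)
      = 1/2 * (\<Sum>x\<in>verts G. \<Sum>y\<in>verts G. if x = y then (g x)\<^sup>2 else 0)
        + 1/2 * (\<Sum>x\<in>verts G. \<Sum>y\<in>verts G. g x * max_degree_walk G x y * g y)"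
    by (simp only: sum.distrib sum_distrib_left)
  also have "(\<Sum>x\<in>verts G. \<Sum>y\<in>verts G. if x = y then (g x)\<^sup>2 else 0) = (\<Sum>x\<in>verts G. (g x)\<^sup>2)"
    by simp
  finally have form: "(\<Sum>x\<in>verts G. \<Sum>y\<in>verts G. g x * lazy (max_degree_walk G) x y * g y)
      = 1/2 * (\<Sum>x\<in>verts G. (g x)\<^sup>2)
        + 1/2 * (\<Sum>x\<in>verts G. \<Sum>y\<in>verts G. g x * max_degree_walk G x y * g y)" .
  have "2 / real (max_degree G) * (1 - cos (pi / card (verts G))) * (\<Sum>x\<in>verts G. (g x)\<^sup>2)
      = 2 * (1 / real (max_degree G) * (1 - cos (pi / card (verts G))) * (\<Sum>x\<in>verts G. (g x)\<^sup>2))"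
    by simp
  then show "1 / real (max_degree G) * (1 - cos (pi / card (verts G))) * (\<Sum>x\<in>verts G. (g x)\<^sup>2)
      \<le> (\<Sum>x\<in>verts G. (g x)\<^sup>2)
        - (\<Sum>x\<in>verts G. \<Sum>y\<in>verts G. g x * lazy (max_degree_walk G) x y * g y)"
    using max_degree_walk_quadratic_form[OF sum0] unfolding form by linarith
qed (simp_all add: two)

lemma two_sided_drifting_max_degree_walk:
  assumes "\<And>A. \<lbrakk>A \<subseteq> verts G; A \<noteq> {}; 2 * card A \<le> card (verts G)\<rbrakk>
    \<Longrightarrow> card A < card (nbrs (verts G) (max_degree_walk G) A)"
  shows "two_sided_drifting (verts G) (arc_weight G) (max_degree G) (1 / real (max_degree G))"
  using assms
  by (intro two_sided_drifting_of_expansion biregular_arc_weight two) (simp add: kernel_arc_weight)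

lemma two_sided_drifting_lazy_max_degree_walk:
  "two_sided_drifting (verts G) (lazy_weight (max_degree G) (arc_weight G)) (2 * max_degree G)
    (1 / real (2 * max_degree G))"
  by (rule two_sided_drifting_lazy[OF biregular_arc_weight two arc_weight_flow_pos])

end

text \<open>
  Here \<open>b\<close> plays the part of the degree: it is \<open>d\<close> for the walk itself and \<open>2 d\<close> for the lazy walk.
\<close>

lemma mixing_bounds_of_two_sided_drifting:
  assumes "two_sided_drifting V W D (1 / b)"
    and P: "biregular.kernel W D = P" and n: "n = card V"
  defines "c \<equiv> 2 / b * (1 - cos (pi / n))"
  shows "\<forall>z. is_eigenvalue V P z \<and> z \<noteq> 1 \<longrightarrow> 1 - cmod z \<ge> c"
    and "\<forall>\<epsilon>>0. tv_mixing_le V (uniform_dist V) P \<epsilon> (inv_neg_log (1 - c) * ln ((1 - 1 / n) / \<epsilon>)) \<and>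
      linf_mixing_le V (uniform_dist V) P \<epsilon>
        (if \<epsilon> \<le> 1
         then min ((ln (real n - 1) + ln (1 / \<epsilon>)) * inv_neg_log (1 - c))
           (real n ^ 2 * b / 3 + real n ^ 2 * b / 4 * ln (1 / \<epsilon>))
         else real n ^ 2 * b * (2 / 3) * ((1 + 3 * \<epsilon>) / (1 + \<epsilon>) ^ 3))"
proof -
  interpret two_sided_drifting V W D "1 / b" by fact
  have rate: "rate = 1 - c" by (simp add: rate_def c_def n)
  show "\<forall>z. is_eigenvalue V P z \<and> z \<noteq> 1 \<longrightarrow> 1 - cmod z \<ge> c"
    using eigenvalue_le_rate rate by (fastforce simp: P)
  show "\<forall>\<epsilon>>0. tv_mixing_le V (uniform_dist V) P \<epsilon> (inv_neg_log (1 - c) * ln ((1 - 1 / n) / \<epsilon>)) \<and>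
      linf_mixing_le V (uniform_dist V) P \<epsilon>
        (if \<epsilon> \<le> 1
         then min ((ln (real n - 1) + ln (1 / \<epsilon>)) * inv_neg_log (1 - c))
           (real n ^ 2 * b / 3 + real n ^ 2 * b / 4 * ln (1 / \<epsilon>))
         else real n ^ 2 * b * (2 / 3) * ((1 + 3 * \<epsilon>) / (1 + \<epsilon>) ^ 3))"
  proof (intro allI impI conjI)
    fix \<epsilon> :: real assume e: "\<epsilon> > 0"
    show "tv_mixing_le V (uniform_dist V) P \<epsilon> (inv_neg_log (1 - c) * ln ((1 - 1 / n) / \<epsilon>))"
      using tv_mixing[OF e] by (simp only: rate P n)
    have b: "x / (1 / b) = x * b" for x by simp
    show "linf_mixing_le V (uniform_dist V) P \<epsilon>
        (if \<epsilon> \<le> 1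
         then min ((ln (real n - 1) + ln (1 / \<epsilon>)) * inv_neg_log (1 - c))
           (real n ^ 2 * b / 3 + real n ^ 2 * b / 4 * ln (1 / \<epsilon>))
         else real n ^ 2 * b * (2 / 3) * ((1 + 3 * \<epsilon>) / (1 + \<epsilon>) ^ 3))"
      using linf_mixing[OF e] by (simp only: rate P n b)
  qed
qed

theorem corollary1p2:
  fixes G :: "('a, 'b) pre_digraph"
    and V :: "'a set" and n d :: nat
    and P :: "'a \<Rightarrow> 'a \<Rightarrow> real" and \<nu> :: "'a \<Rightarrow> real"
  assumes "eulerian_digraph G"
    and "V = verts G" and "n = card V" and "n \<ge> 2"
    and "d = max_degree G"
    and "P = max_degree_walk G"
    and "\<nu> = uniform_dist V"
  shows
    "spectral_gap V \<nu> P \<ge> 2 / d * (1 - cos (pi / n))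
   \<and>
     ((\<forall>A. A \<subseteq> V \<and> A \<noteq> {} \<and> real (card A) \<le> real (card V) / 2 \<longrightarrow> card (nbrs V P A) > card A)
      \<longrightarrow>
       (\<forall>z. is_eigenvalue V P z \<and> z \<noteq> 1 \<longrightarrow> 1 - cmod z \<ge> 2 / d * (1 - cos (pi / n))) \<and>
       (\<forall>\<epsilon>>0.
          tv_mixing_le V \<nu> P \<epsilon>
            (inv_neg_log (1 - 2 / d * (1 - cos (pi / n))) * ln ((1 - 1 / n) / \<epsilon>)) \<and>
          linf_mixing_le V \<nu> P \<epsilon>
            (if \<epsilon> \<le> 1
             then min ((ln (real n - 1) + ln (1 / \<epsilon>)) * inv_neg_log (1 - 2 / d * (1 - cos (pi / n))))
                      (real n ^ 2 * d / 3 + real n ^ 2 * d / 4 * ln (1 / \<epsilon>))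
             else real n ^ 2 * d * (2 / 3) * ((1 + 3 * \<epsilon>) / (1 + \<epsilon>) ^ 3))))
   \<and>
     (spectral_gap V \<nu> (lazy P) \<ge> 1 / d * (1 - cos (pi / n)) \<and>
      (\<forall>z. is_eigenvalue V (lazy P) z \<and> z \<noteq> 1 \<longrightarrow> 1 - cmod z \<ge> 1 / d * (1 - cos (pi / n))) \<and>
      (\<forall>\<epsilon>>0.
          tv_mixing_le V \<nu> (lazy P) \<epsilon>
            (inv_neg_log (1 - 1 / d * (1 - cos (pi / n))) * ln ((1 - 1 / n) / \<epsilon>)) \<and>
          linf_mixing_le V \<nu> (lazy P) \<epsilon>
            (if \<epsilon> \<le> 1
             then min ((ln (real n - 1) + ln (1 / \<epsilon>)) * inv_neg_log (1 - 1 / d * (1 - cos (pi / n))))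
                      (2 * real n ^ 2 * d / 3 + real n ^ 2 * d / 2 * ln (1 / \<epsilon>))
             else real n ^ 2 * d * (4 / 3) * ((1 + 3 * \<epsilon>) / (1 + \<epsilon>) ^ 3))))"
    (is "?gap \<and> (?expanding \<longrightarrow> ?bounds) \<and> ?lazy_gap \<and> ?lazy_bounds")
proof -
  note V = \<open>V = verts G\<close> and n = \<open>n = card V\<close> and d = \<open>d = max_degree G\<close>
    and P = \<open>P = max_degree_walk G\<close> and \<nu> = \<open>\<nu> = uniform_dist V\<close>
  have two: "card (verts G) \<ge> 2" using \<open>n \<ge> 2\<close> by (simp add: n V)
  note eul = \<open>eulerian_digraph G\<close>
  have ?gap
    using spectral_gap_max_degree_walk[OF eul two] by (simp only: V n d P \<nu>)
  moreover have ?bounds if exp: ?expanding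
  proof -
    have "two_sided_drifting V (arc_weight G) d (1 / real d)"
      unfolding V d
    proof (rule two_sided_drifting_max_degree_walk[OF eul two])
      fix A assume "A \<subseteq> verts G" "A \<noteq> {}" "2 * card A \<le> card (verts G)"
      moreover from this have "real (card A) \<le> real (card (verts G)) / 2" by linarith
      ultimately show "card A < card (nbrs (verts G) (max_degree_walk G) A)"
        using exp unfolding V P by blast
    qed
    note bounds = mixing_bounds_of_two_sided_drifting[OF this _ n, of P]
    have kernel: "biregular.kernel (arc_weight G) d = P"
      unfolding P d by (rule kernel_arc_weight[OF eul two])
    show ?thesis using bounds[OF kernel] unfolding \<nu> by blast
  qed
  moreover have ?lazy_gap
    using spectral_gap_lazy_max_degree_walk[OF eul two] by (simp only: V n d P \<nu>)
  moreover have ?lazy_bounds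
  proof -
    have "two_sided_drifting V (lazy_weight d (arc_weight G)) (2 * d) (1 / real (2 * d))"
      unfolding V d by (rule two_sided_drifting_lazy_max_degree_walk[OF eul two])
    note bounds = mixing_bounds_of_two_sided_drifting[OF this _ n, of "lazy P"]
    have kernel: "biregular.kernel (lazy_weight d (arc_weight G)) (2 * d) = lazy P"
      unfolding P d by (rule kernel_lazy_weight[OF eul two])
    have scale: "2 / real (2 * d) = 1 / real d"
      "real n ^ 2 * real (2 * d) / 3 = 2 * real n ^ 2 * real d / 3"
      "real n ^ 2 * real (2 * d) / 4 = real n ^ 2 * real d / 2"
      "real n ^ 2 * real (2 * d) * (2 / 3) = real n ^ 2 * real d * (4 / 3)"
      by simp_all
    show ?thesis using bounds[OF kernel] unfolding \<nu> scale by blast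
  qed
  ultimately show ?thesis by blast
qed

end
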